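(* Let $L:\mathbb{R}^n\times\mathbb{R}^m\to\mathbb{R}$ be twice differentiable and $\rho$-weakly convex-weakly concave, and suppose that for constants $\beta,H,\delta,\xi\ge0$: (a) $\|\nabla^2L(z)\|\le\beta$ for all $z$; (b) $\|\nabla^2L(z)-\nabla^2L(\bar z)\|\le H\|z-\bar z\|$ for all $z,\bar z$; (c) $\|\nabla^2_{xy}L(z)\|\le\delta$ for all $z$; (d) $\|\nabla^2_{xx}L(x,y)-\nabla^2_{xx}L(x,\bar y)\|\le\xi\|y-\bar y\|$ and $\|\nabla^2_{yy}L(x,y)-\nabla^2_{yy}L(\bar x,y)\|\le\xi\|x-\bar x\|$ for all $(x,y),(\bar x,\bar y)$. Let $\eta>0$ with $\eta>\rho$. Fix $z'=(x',y')$, let $x_0$ be a local minimizer of $u\mapsto L(u,y')$, let $y_0$ be a local maximizer of $v\mapsto L(x',v)$, and put $z_0=(x_0,y_0)$. Let $\mu\ge0$ be such that $\nabla^2_{xx}L(x_0,y')\succeq\mu I$ and $-\nabla^2_{yy}L(x',y_0)\succeq\mu I$. Assume that $\delta$ and $\xi$ are small enough that $$\xi\|y_0-y'\|<\mu+\frac{\lambda_{\min}(\nabla^2_{xy}L(z_0)\nabla^2_{yx}L(z_0))}{\eta+\beta},\qquad \xi\|x_0-x'\|<\mu+\frac{\lambda_{\min}(\nabla^2_{yx}L(z_0)\nabla^2_{xy}L(z_0))}{\eta+\beta},$$ so that interaction dominance at the point $z_0$ holds in both $x$ and $y$ with some constant $\alpha_0>0$, and, for this $\alpha_0$, $$\delta\|z_0-z'\|\le\frac{\alpha_0(\eta-\rho)}{2\left(1+\frac{4\sqrt2(\eta+\alpha_0/2)}{\alpha_0}+\frac{4\sqrt2\,\beta(\eta+\alpha_0/2)}{\alpha_0(\eta-\rho)}\right)H\left(1+\frac{2\delta}{\eta-\rho}+\frac{\delta^2}{(\eta-\rho)^2}\right)}.$$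 Let $\lambda\in(0,1]$ satisfy $$\lambda\le2\,\frac{\min\{1,(\eta/\rho-1)^2\}}{2\eta/\alpha_0+1}.$$ Then the damped proximal point method with parameters $\eta,\lambda$ started at $(x_0,y_0)$ linearly converges to a nearby stationary point $(x^*,y^* )$ of the problem $\min_x\max_y L(x,y)$, with $$\left\|\begin{bmatrix} x_k-x^*\\ y_k-y^*\end{bmatrix}\right\|^2\le\left(1-\frac{2\lambda}{2\eta/\alpha_0+1}+\frac{\lambda^2}{\min\{1,(\eta/\rho-1)^2\}}\right)^k\left\|\begin{bmatrix} x_0-x^*\\ y_0-y^*\end{bmatrix}\right\|^2 .$$
   Context: A twice differentiable $L$ is $\rho$-weakly convex-weakly concave ($\rho\in\mathbb{R}$) if $\nabla^2_{xx}L(z)\succeq-\rho I$ and $-\nabla^2_{yy}L(z)\succeq-\rho I$ for all $z=(x,y)$. A stationary point is a $z$ with $\nabla L(z)=0$. Matrix norms are operator norms; $\lambda_{\min}$ denotes the smallest eigenvalue. Interaction dominance at the point $z_0$ holds in both $x$ and $y$ with constant $\alpha_0$ if $$\nabla^2_{xx}L(z_0)+\nabla^2_{xy}L(z_0)(\eta I-\nabla^2_{yy}L(z_0))^{-1}\nabla^2_{yx}L(z_0)\succeq\alpha_0 I,$$ $$-\nabla^2_{yy}L(z_0)+\nabla^2_{yx}L(z_0)(\eta I+\nabla^2_{xx}L(z_0))^{-1}\nabla^2_{xy}L(z_0)\succeq\alpha_0 I.$$ The proximal operator is $\mathrm{prox}_\eta(x,y)=\arg\min_{u\in\mathbb{R}^n}\max_{v\in\mathbb{R}^m}L(u,v)+\frac{\eta}{2}\|u-x\|^2-\frac{\eta}{2}\|v-y\|^2$,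 meaning the unique minimax (saddle) point $(u,v)$ of this strongly convex-strongly concave problem. The damped proximal point method with damping $\lambda\in(0,1]$ is $(x_{k+1},y_{k+1})=(1-\lambda)(x_k,y_k)+\lambda\,\mathrm{prox}_\eta(x_k,y_k)$. Conventions: if $\rho=0$, $\min\{1,(\eta/\rho-1)^2\}$ is read as $1$; if $H=0$, the upper bound on $\delta\|z_0-z'\|$ is read as $+\infty$. *)

theory Defs
  imports "HOL-Analysis.Analysis"
begin

section \<open>Gradient and Hessian\<close>

definition grad :: "('a::real_inner \<Rightarrow> real) \<Rightarrow> 'a \<Rightarrow> 'a" where
  "grad f z = (THE g. GDERIV f z :> g)"

definition twice_differentiable :: "('a::real_inner \<Rightarrow> real) \<Rightarrow> bool" where
  "twice_differentiable f \<longleftrightarrow>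
     (\<forall>z. f differentiable (at z)) \<and> (\<forall>z. grad f differentiable (at z))"

text \<open>The full Hessian is kept as a linear operator, because its index set would be a disjoint
  union; its operator norm is then \<open>onorm\<close>. The blocks are matrices.\<close>

definition hess :: "('a::real_inner \<Rightarrow> real) \<Rightarrow> 'a \<Rightarrow> 'a \<Rightarrow> 'a" where
  "hess f z = frechet_derivative (grad f) (at z)"

definition hess_xx :: "((real^'n) \<times> (real^'m) \<Rightarrow> real) \<Rightarrow> (real^'n) \<times> (real^'m) \<Rightarrow> real^'n^'n" where
  "hess_xx L z = matrix (\<lambda>h. fst (hess L z (h, 0)))"

text \<open>\<open>hess_xy\<close> is the \<open>n \<times> m\<close> derivative in \<open>y\<close> of the partial gradient in \<open>x\<close>.\<close>

definition hess_xy :: "((real^'n) \<times> (real^'m) \<Rightarrow> real) \<Rightarrow> (real^'n) \<times> (real^'m) \<Rightarrow> real^'m^'n" where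
  "hess_xy L z = matrix (\<lambda>h. fst (hess L z (0, h)))"

definition hess_yx :: "((real^'n) \<times> (real^'m) \<Rightarrow> real) \<Rightarrow> (real^'n) \<times> (real^'m) \<Rightarrow> real^'n^'m" where
  "hess_yx L z = matrix (\<lambda>h. snd (hess L z (h, 0)))"

definition hess_yy :: "((real^'n) \<times> (real^'m) \<Rightarrow> real) \<Rightarrow> (real^'n) \<times> (real^'m) \<Rightarrow> real^'m^'m" where
  "hess_yy L z = matrix (\<lambda>h. snd (hess L z (0, h)))"


section \<open>Matrix notions\<close>

definition opnorm :: "real^'a^'b \<Rightarrow> real" where
  "opnorm A = onorm (\<lambda>v. A *v v)"

text \<open>Loewner order. Symmetry is not demanded: it holds automatically for all matrices that
  are compared below. Recall that \<open>mat c\<close> is \<open>c\<close> times the identity matrix.\<close>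

definition loewner_ge :: "real^'a^'a \<Rightarrow> real^'a^'a \<Rightarrow> bool"  (infix "\<succeq>" 50) where
  "A \<succeq> B \<longleftrightarrow> (\<forall>v. v \<bullet> ((A - B) *v v) \<ge> 0)"

definition is_eigenvalue :: "real^'a^'a \<Rightarrow> real \<Rightarrow> bool" where
  "is_eigenvalue A c \<longleftrightarrow> (\<exists>v. v \<noteq> 0 \<and> A *v v = c *\<^sub>R v)"

definition lambda_min :: "real^'a^'a \<Rightarrow> real" where
  "lambda_min A = (LEAST c. is_eigenvalue A c)"


section \<open>The minimax problem\<close>

definition weakly_convex_concave :: "((real^'n) \<times> (real^'m) \<Rightarrow> real) \<Rightarrow> real \<Rightarrow> bool" where
  "weakly_convex_concave L \<rho> \<longleftrightarrow>
     (\<forall>z. hess_xx L z \<succeq> mat (- \<rho>) \<and> - hess_yy L z \<succeq> mat (- \<rho>))"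

definition stationary_point :: "((real^'n) \<times> (real^'m) \<Rightarrow> real) \<Rightarrow> (real^'n) \<times> (real^'m) \<Rightarrow> bool" where
  "stationary_point L z \<longleftrightarrow> grad L z = 0"

definition interaction_dominant ::
    "((real^'n) \<times> (real^'m) \<Rightarrow> real) \<Rightarrow> real \<Rightarrow> (real^'n) \<times> (real^'m) \<Rightarrow> real \<Rightarrow> bool" where
  "interaction_dominant L \<eta> z \<alpha> \<longleftrightarrow>
     hess_xx L z + hess_xy L z ** matrix_inv (mat \<eta> - hess_yy L z) ** hess_yx L z \<succeq> mat \<alpha> \<and>
     - hess_yy L z + hess_yx L z ** matrix_inv (mat \<eta> + hess_xx L z) ** hess_xy L z \<succeq> mat \<alpha>"

definition local_minimizer :: "('a::topological_space \<Rightarrow> real) \<Rightarrow> 'a \<Rightarrow> bool" where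
  "local_minimizer f x \<longleftrightarrow> (\<forall>\<^sub>F u in nhds x. f x \<le> f u)"

definition local_maximizer :: "('a::topological_space \<Rightarrow> real) \<Rightarrow> 'a \<Rightarrow> bool" where
  "local_maximizer f x \<longleftrightarrow> (\<forall>\<^sub>F u in nhds x. f u \<le> f x)"

text \<open>Global saddle point of the problem of minimizing over the first and maximizing over the
  second component.\<close>

definition saddle_point :: "('a \<times> 'b \<Rightarrow> real) \<Rightarrow> 'a \<times> 'b \<Rightarrow> bool" where
  "saddle_point f p \<longleftrightarrow>
     (\<forall>u. f p \<le> f (u, snd p)) \<and> (\<forall>v. f (fst p, v) \<le> f p)"

definition prox ::
    "((real^'n) \<times> (real^'m) \<Rightarrow> real) \<Rightarrow> real \<Rightarrow> (real^'n) \<times> (real^'m) \<Rightarrow> (real^'n) \<times> (real^'m)" where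
  "prox L \<eta> z = (THE p. saddle_point
     (\<lambda>(u, v). L (u, v) + \<eta> / 2 * (norm (u - fst z))\<^sup>2 - \<eta> / 2 * (norm (v - snd z))\<^sup>2) p)"

primrec damped_ppm ::
    "((real^'n) \<times> (real^'m) \<Rightarrow> real) \<Rightarrow> real \<Rightarrow> real \<Rightarrow> (real^'n) \<times> (real^'m) \<Rightarrow> nat
      \<Rightarrow> (real^'n) \<times> (real^'m)" where
  "damped_ppm L \<eta> lam z0 0 = z0"
| "damped_ppm L \<eta> lam z0 (Suc k) =
     (1 - lam) *\<^sub>R damped_ppm L \<eta> lam z0 k + lam *\<^sub>R prox L \<eta> (damped_ppm L \<eta> lam z0 k)"

definition linearly_converges :: "(nat \<Rightarrow> 'a::real_normed_vector) \<Rightarrow> 'a \<Rightarrow> bool" where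
  "linearly_converges z zs \<longleftrightarrow>
     (\<exists>C q. 0 \<le> q \<and> q < 1 \<and> (\<forall>k. norm (z k - zs) \<le> C * q ^ k))"

text \<open>The quantity \<open>min {1, (\<eta>/\<rho> - 1)\<^sup>2}\<close>, read as \<open>1\<close> if \<open>\<rho> = 0\<close>.\<close>

definition kappa :: "real \<Rightarrow> real \<Rightarrow> real" where
  "kappa \<eta> \<rho> = (if \<rho> = 0 then 1 else min 1 ((\<eta> / \<rho> - 1)\<^sup>2))"

end

theory Submission
  imports Defs
begin

text \<open>Write \<open>F = (\<nabla>\<^sub>x L, - \<nabla>\<^sub>y L)\<close>. The proximal point \<open>p\<close> of \<open>z\<close> is the only solution of
  \<open>F p + \<eta> (p - z) = 0\<close>. For two points \<open>z\<close>, \<open>z'\<close> with proximal points \<open>p\<close>, \<open>q\<close> let \<open>M\<close> be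
  the average of the derivative of \<open>F\<close> over the segment from \<open>q\<close> to \<open>p\<close>; then
  \<open>\<eta> (z - z') = (M + \<eta>) (p - q)\<close> and \<open>\<eta> ((z - p) - (z' - q)) = M (p - q)\<close>. Interaction dominance
  of \<open>M\<close> with constant \<open>\<alpha>\<close> makes the displacement \<open>z - p\<close> strongly monotone with constant
  \<open>\<alpha> / (\<eta> + \<alpha>)\<close>, and weak convexity makes it Lipschitz with constant \<open>kappa \<eta> \<rho> powr (- 1 / 2)\<close>,
  which gives the contraction rate. Since the Hessian is Lipschitz, dominance with constant \<open>\<alpha>0\<close>
  at \<open>z0\<close> persists with a constant above \<open>\<alpha>0 / 2\<close> for the averages belonging to a ball around
  \<open>z0\<close>. The displacement at \<open>z0\<close> is so small that the ball contains a stationary point, by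
  Banach's theorem, and all iterates.\<close>

section \<open>Operators of saddle type\<close>

text \<open>Turns the gradient of \<open>L\<close> into the field \<open>F\<close> of the minimax
  problem. As an isometric involution it passes freely between symmetric Hessians and monotone
  operators.\<close>

definition flip_snd :: "'a \<times> 'b::ab_group_add \<Rightarrow> 'a \<times> 'b" where
  "flip_snd w = (fst w, - snd w)"

lemma flip_snd_simps [simp]:
  "fst (flip_snd w) = fst w" "snd (flip_snd w) = - snd w"
  "flip_snd (flip_snd w) = w" "flip_snd (a, b) = (a, - b)"
  by (simp_all add: flip_snd_def)

lemma linear_flip_snd: "linear (flip_snd :: 'a::real_vector \<times> 'b::real_vector \<Rightarrow> _)"
  by (rule linearI) (auto simp: flip_snd_def)

lemma norm_flip_snd [simp]:
  "norm (flip_snd w) = norm (w :: 'a::real_normed_vector \<times> 'b::real_normed_vector)"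
  by (cases w) (simp add: norm_Pair)

lemma norm_Pair_power2:
  "(norm (a, b))\<^sup>2 = (norm (a::'a::real_normed_vector))\<^sup>2 + (norm (b::'b::real_normed_vector))\<^sup>2"
  by (simp add: norm_Pair)

text \<open>Expand \<open>0 \<le> (norm (v - c *\<^sub>R a))\<^sup>2\<close>. With \<open>v\<close>
  the image of \<open>a\<close> under a strongly monotone map, this bounds the quadratic form of the
  inverse map from above.\<close>

lemma inner_le_if_strongly_monotone:
  fixes a v :: "'a::real_inner"
  assumes "c * (norm a)\<^sup>2 \<le> a \<bullet> v" "0 < c"
  shows "a \<bullet> v \<le> (norm v)\<^sup>2 / c"
proof -
  have "0 \<le> (norm (v - c *\<^sub>R a))\<^sup>2" by simp
  also have "\<dots> = (norm v)\<^sup>2 - 2 * c * (a \<bullet> v) + c * (c * (norm a)\<^sup>2)"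
    unfolding power2_norm_eq_inner
    by (simp add: inner_diff_left inner_diff_right inner_commute algebra_simps power2_eq_square)
  also have "\<dots> \<le> (norm v)\<^sup>2 - 2 * c * (a \<bullet> v) + c * (a \<bullet> v)"
    using assms by (intro add_left_mono mult_left_mono) auto
  finally show ?thesis using assms by (simp add: field_simps)
qed

lemma norm_le_if_strongly_monotone:
  fixes a v :: "'a::real_inner"
  assumes "c * (norm a)\<^sup>2 \<le> a \<bullet> v" "0 < c"
  shows "norm a \<le> norm v / c"
proof (cases "a = 0")
  case False
  have "c * norm a * norm a \<le> norm v * norm a"
    using assms(1) norm_cauchy_schwarz[of a v] by (simp add: power2_eq_square algebra_simps)
  then show ?thesis using False assms(2) by (simp add: field_simps)
qed (use assms in simp)

section \<open>The constant \<open>kappa\<close> as a Lipschitz bound for displacements\<close>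

lemma kappa_pos: "0 < \<eta> \<Longrightarrow> \<rho> < \<eta> \<Longrightarrow> 0 < kappa \<eta> \<rho>"
  by (auto simp: kappa_def)

lemma kappa_le_1: "kappa \<eta> \<rho> \<le> 1"
  by (auto simp: kappa_def)

text \<open>If \<open>2 * \<rho> \<le> \<eta>\<close>, expanding the square on the right leaves
  \<open>(norm m)\<^sup>2\<close> plus a nonnegative multiple of \<open>(norm w)\<^sup>2\<close>.
  Otherwise that multiple is negative and is absorbed by
  \<open>norm w \<le> norm n / (\<eta> - \<rho>)\<close>; the identity \<open>(\<eta> -
  \<rho>)\<^sup>2 + \<eta> * (2 * \<rho> - \<eta>) = \<rho>\<^sup>2\<close> then produces the factor
  \<open>(\<eta> / \<rho> - 1)\<^sup>2\<close>.\<close>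

lemma kappa_norm_le:
  fixes m w :: "'a::real_inner"
  assumes mono: "- \<rho> * (norm w)\<^sup>2 \<le> w \<bullet> m" and \<eta>: "0 < \<eta>" "\<rho> < \<eta>"
  shows "kappa \<eta> \<rho> * (norm m)\<^sup>2 \<le> (norm (m + \<eta> *\<^sub>R w))\<^sup>2"
proof -
  define n where "n = m + \<eta> *\<^sub>R w"
  have n2: "(norm n)\<^sup>2 = (norm m)\<^sup>2 + 2 * \<eta> * (w \<bullet> m) + \<eta>\<^sup>2 * (norm w)\<^sup>2"
    unfolding n_def power2_norm_eq_inner
    by (simp add: inner_add_left inner_add_right inner_commute algebra_simps power2_eq_square)
  have n_ge: "(norm m)\<^sup>2 + \<eta> * (\<eta> - 2 * \<rho>) * (norm w)\<^sup>2 \<le> (norm n)\<^sup>2"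
    using mult_left_mono[OF mono, of "2 * \<eta>"] \<eta> unfolding n2
    by (simp add: algebra_simps power2_eq_square)
  show ?thesis
  proof (cases "2 * \<rho> \<le> \<eta>")
    case True
    have "kappa \<eta> \<rho> * (norm m)\<^sup>2 \<le> 1 * (norm m)\<^sup>2"
      by (intro mult_right_mono kappa_le_1) simp
    also have "\<dots> \<le> (norm n)\<^sup>2"
      using n_ge True \<eta> by (smt (verit) mult_nonneg_nonneg zero_le_power2)
    finally show ?thesis unfolding n_def .
  next
    case False
    with \<eta> have \<rho>: "0 < \<rho>" by simp
    have "(\<eta> - \<rho>) * (norm w)\<^sup>2 \<le> w \<bullet> n"
      using mono by (simp add: n_def inner_add_right power2_norm_eq_inner algebra_simps)
    then have "norm w \<le> norm n / (\<eta> - \<rho>)"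
      by (rule norm_le_if_strongly_monotone) (use \<eta> in simp)
    then have "(norm w)\<^sup>2 \<le> (norm n / (\<eta> - \<rho>))\<^sup>2"
      by (intro power_mono) auto
    then have w: "(\<eta> - \<rho>)\<^sup>2 * (norm w)\<^sup>2 \<le> (norm n)\<^sup>2"
      using \<eta> by (simp add: power_divide field_simps)
    have "(\<eta> - \<rho>)\<^sup>2 * (norm m)\<^sup>2
        \<le> (\<eta> - \<rho>)\<^sup>2 * (norm n)\<^sup>2 + \<eta> * (2 * \<rho> - \<eta>) * ((\<eta> - \<rho>)\<^sup>2 * (norm w)\<^sup>2)"
      using mult_left_mono[OF n_ge, of "(\<eta> - \<rho>)\<^sup>2"] by (simp add: algebra_simps)
    also have "\<dots> \<le> (\<eta> - \<rho>)\<^sup>2 * (norm n)\<^sup>2 + \<eta> * (2 * \<rho> - \<eta>) * (norm n)\<^sup>2"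
      using False \<eta> by (intro add_left_mono mult_left_mono w) auto
    also have "\<dots> = \<rho>\<^sup>2 * (norm n)\<^sup>2"
      by (simp add: algebra_simps power2_eq_square)
    finally have *: "(\<eta> / \<rho> - 1)\<^sup>2 * (norm m)\<^sup>2 \<le> (norm n)\<^sup>2"
      using \<rho> by (simp add: field_simps power2_eq_square)
    have "kappa \<eta> \<rho> * (norm m)\<^sup>2 \<le> (\<eta> / \<rho> - 1)\<^sup>2 * (norm m)\<^sup>2"
      using \<rho> by (intro mult_right_mono) (auto simp: kappa_def)
    with * show ?thesis unfolding n_def by linarith
  qed
qed

text \<open>Interaction dominance without inverses: \<open>x \<bullet> B Q\<^sup>-\<^sup>1 B\<^sup>T x\<close> is the maximum
  over \<open>y\<close> of \<open>2 * (y \<bullet> B\<^sup>T x) - y \<bullet> Q y\<close>. In this form the condition is stable under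
  perturbation and averaging of the operator, and a bounded witness suffices.\<close>

definition dominant_fst ::
    "('a::real_inner \<times> 'b::real_inner \<Rightarrow> 'a \<times> 'b) \<Rightarrow> real \<Rightarrow> real \<Rightarrow> real \<Rightarrow> bool" where
  "dominant_fst S \<eta> r \<alpha> \<longleftrightarrow>
     (\<forall>a. \<exists>b. norm b \<le> r * norm a \<and>
        \<alpha> * (norm a)\<^sup>2 \<le> (a, b) \<bullet> S (a, b) - \<eta> * (norm b)\<^sup>2)"

text \<open>The form enters with the opposite sign because \<open>y\<close> is maximized over. The
  optimal witness is therefore \<open>- Q\<^sup>-\<^sup>1 B b\<close>, with \<open>Q\<close> the
  first diagonal block plus \<open>\<eta>\<close>.\<close>

definition dominant_snd ::
    "('a::real_inner \<times> 'b::real_inner \<Rightarrow> 'a \<times> 'b) \<Rightarrow> real \<Rightarrow> real \<Rightarrow> real \<Rightarrow> bool" where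
  "dominant_snd S \<eta> r \<alpha> \<longleftrightarrow>
     (\<forall>b. \<exists>a. norm a \<le> r * norm b \<and>
        \<alpha> * (norm b)\<^sup>2 \<le> - ((a, b) \<bullet> S (a, b)) - \<eta> * (norm a)\<^sup>2)"

lemma inner_perturbation:
  fixes w :: "'a::real_inner"
  assumes "norm (S' w - S w) \<le> e * norm w"
  shows "\<bar>w \<bullet> S' w - w \<bullet> S w\<bar> \<le> e * (norm w)\<^sup>2"
proof -
  have "\<bar>w \<bullet> S' w - w \<bullet> S w\<bar> = \<bar>w \<bullet> (S' w - S w)\<bar>" by (simp add: inner_diff_right)
  also have "\<dots> \<le> norm w * norm (S' w - S w)" by (rule Cauchy_Schwarz_ineq2)
  also have "\<dots> \<le> norm w * (e * norm w)" using assms by (intro mult_left_mono) auto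
  finally show ?thesis by (simp add: power2_eq_square algebra_simps)
qed

lemma norm_Pair_power2_le:
  fixes a :: "'a::real_normed_vector" and b :: "'b::real_normed_vector"
  assumes "norm b \<le> r * norm a"
  shows "(norm (a, b))\<^sup>2 \<le> (1 + r\<^sup>2) * (norm a)\<^sup>2"
  using power_mono[OF assms, of 2] by (simp add: norm_Pair_power2 power_mult_distrib algebra_simps)

text \<open>The witness for \<open>S\<close> is kept for \<open>S'\<close>. Its bound makes the
  error in the quadratic form at \<open>(a, b)\<close> a multiple of
  \<open>(norm a)\<^sup>2\<close>, and this is what \<open>r\<close> is for.\<close>

lemma dominant_fst_perturbation:
  assumes dom: "dominant_fst S \<eta> r \<alpha>" and "0 \<le> e"
    and le: "\<And>w. norm (S' w - S w) \<le> e * norm w"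
  shows "dominant_fst S' \<eta> r (\<alpha> - e * (1 + r\<^sup>2))"
  unfolding dominant_fst_def
proof
  fix a
  obtain b where b: "norm b \<le> r * norm a"
    "\<alpha> * (norm a)\<^sup>2 \<le> (a, b) \<bullet> S (a, b) - \<eta> * (norm b)\<^sup>2"
    using dom unfolding dominant_fst_def by blast
  have "e * (norm (a, b))\<^sup>2 \<le> e * ((1 + r\<^sup>2) * (norm a)\<^sup>2)"
    using norm_Pair_power2_le[OF b(1)] \<open>0 \<le> e\<close> by (rule mult_left_mono)
  with b inner_perturbation[where w = "(a, b)" and S' = S' and S = S, OF le]
  show "\<exists>b. norm b \<le> r * norm a \<and>
      (\<alpha> - e * (1 + r\<^sup>2)) * (norm a)\<^sup>2 \<le> (a, b) \<bullet> S' (a, b) - \<eta> * (norm b)\<^sup>2"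
    by (intro exI[of _ b]) (simp add: algebra_simps)
qed

lemma dominant_snd_perturbation:
  assumes dom: "dominant_snd S \<eta> r \<alpha>" and "0 \<le> e"
    and le: "\<And>w. norm (S' w - S w) \<le> e * norm w"
  shows "dominant_snd S' \<eta> r (\<alpha> - e * (1 + r\<^sup>2))"
  unfolding dominant_snd_def
proof
  fix b
  obtain a where a: "norm a \<le> r * norm b"
    "\<alpha> * (norm b)\<^sup>2 \<le> - ((a, b) \<bullet> S (a, b)) - \<eta> * (norm a)\<^sup>2"
    using dom unfolding dominant_snd_def by blast
  have "(norm (a, b))\<^sup>2 \<le> (1 + r\<^sup>2) * (norm b)\<^sup>2"
    using norm_Pair_power2_le[OF a(1)] by (simp add: norm_Pair_power2)
  then have "e * (norm (a, b))\<^sup>2 \<le> e * ((1 + r\<^sup>2) * (norm b)\<^sup>2)"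
    using \<open>0 \<le> e\<close> by (rule mult_left_mono)
  with a inner_perturbation[where w = "(a, b)" and S' = S' and S = S, OF le]
  show "\<exists>a. norm a \<le> r * norm b \<and>
      (\<alpha> - e * (1 + r\<^sup>2)) * (norm b)\<^sup>2 \<le> - ((a, b) \<bullet> S' (a, b)) - \<eta> * (norm a)\<^sup>2"
    by (intro exI[of _ a]) (simp add: algebra_simps)
qed

text \<open>Abstracts a symmetric Hessian of a weakly convex-weakly concave function. The conditions
  survive averaging, so that they hold for Hessians at a point and for their means over segments
  alike.\<close>

locale saddle_operator =
  fixes S :: "'a::euclidean_space \<times> 'b::euclidean_space \<Rightarrow> 'a \<times> 'b" and \<rho> \<eta> :: real
  assumes lin: "linear S" and self: "v \<bullet> S w = w \<bullet> S v"
    and fst_ge: "- \<rho> * (norm a)\<^sup>2 \<le> (a, 0) \<bullet> S (a, 0)"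
    and snd_le: "(0, b) \<bullet> S (0, b) \<le> \<rho> * (norm b)\<^sup>2"
    and eta_pos: "0 < \<eta>" and rho_less: "\<rho> < \<eta>"
begin

text \<open>The derivative of the proximal equation \<open>F p + \<eta> (p - z) = 0\<close> with
  respect to \<open>p\<close>.\<close>

definition N :: "'a \<times> 'b \<Rightarrow> 'a \<times> 'b" where
  "N w = flip_snd (S w) + \<eta> *\<^sub>R w"

text \<open>Flipping the second component makes the off-diagonal part skew, so only the two diagonal
  blocks contribute to the quadratic form.\<close>

lemma monotone: "- \<rho> * (norm w)\<^sup>2 \<le> w \<bullet> flip_snd (S w)"
proof -
  obtain a b where w: "w = (a, b)" by force
  have S: "S w = S (a, 0) + S (0, b)"
    using linear_add[OF lin, of "(a, 0)" "(0, b)"] by (simp add: w)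
  have "w \<bullet> flip_snd (S w) = (a, 0) \<bullet> S (a, 0) - (0, b) \<bullet> S (0, b)
      + ((a, 0) \<bullet> S (0, b) - (0, b) \<bullet> S (a, 0))"
    unfolding S by (simp add: w inner_prod_def inner_add_right inner_diff_right)
  then show ?thesis
    using fst_ge[of a] snd_le[of b] self[of "(a, 0)" "(0, b)"]
    by (simp add: w norm_Pair_power2 algebra_simps)
qed

lemma N_monotone: "(\<eta> - \<rho>) * (norm w)\<^sup>2 \<le> w \<bullet> N w"
  using monotone[of w] by (simp add: N_def inner_add_right power2_norm_eq_inner algebra_simps)

lemma linear_N: "linear N"
  unfolding N_def
  by (intro linear_compose_add linear_compose[OF lin linear_flip_snd, unfolded o_def]
      linear_compose_scale_right linear_ident)

lemma inj_N: "inj N"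
  unfolding linear_injective_0[OF linear_N]
proof (intro allI impI)
  fix w assume "N w = 0"
  with N_monotone[of w] have "(\<eta> - \<rho>) * (norm w)\<^sup>2 \<le> 0" by simp
  with rho_less show "w = 0" by (simp add: mult_le_0_iff)
qed

lemma surj_N: "surj N"
  using linear_injective_imp_surjective[OF linear_N inj_N] by simp

text \<open>The zero second component of \<open>N (a, b)\<close> says that \<open>b\<close> is a
  critical point of the concave function \<open>k \<mapsto> (a, k) \<bullet> S (a, k) - \<eta> *
  (norm k)\<^sup>2\<close>, hence its maximizer, with value
  \<open>a \<bullet> v - \<eta> * (norm a)\<^sup>2\<close>. The witness of dominance cannot exceed
  this value. In matrix terms, \<open>v\<close> is the Schur complement applied to
  \<open>a\<close>.\<close>

lemma N_fst_coercive:
  assumes dom: "dominant_fst S \<eta> r \<alpha>" and N: "N (a, b) = (v, 0)"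
  shows "(\<eta> + \<alpha>) * (norm a)\<^sup>2 \<le> a \<bullet> v"
proof -
  obtain k where k: "\<alpha> * (norm a)\<^sup>2 \<le> (a, k) \<bullet> S (a, k) - \<eta> * (norm k)\<^sup>2"
    using dom unfolding dominant_fst_def by blast
  define e where "e = k - b"
  have S: "S (a, b) = (v - \<eta> *\<^sub>R a, \<eta> *\<^sub>R b)"
  proof -
    have "flip_snd (S (a, b)) = (v, 0) - \<eta> *\<^sub>R (a, b)"
      using N by (metis N_def add_diff_cancel_right')
    from arg_cong[OF this, of flip_snd] show ?thesis by simp
  qed
  have split: "(a, k) = (a, b) + (0, e)" by (simp add: e_def)
  have "(a, k) \<bullet> S (a, k)
      = (a, b) \<bullet> S (a, b) + 2 * ((0, e) \<bullet> S (a, b)) + (0, e) \<bullet> S (0, e)"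
    unfolding split linear_add[OF lin] inner_add_left inner_add_right
    using self[of "(a, b)" "(0, e)"] by simp
  also have "\<dots> \<le> a \<bullet> v - \<eta> * (norm a)\<^sup>2 + \<eta> * (norm b)\<^sup>2 + 2 * \<eta> * (e \<bullet> b) + \<rho> * (norm e)\<^sup>2"
    using snd_le[of e]
    by (simp add: S inner_Pair inner_diff_right power2_norm_eq_inner algebra_simps)
  finally have "\<alpha> * (norm a)\<^sup>2 \<le> a \<bullet> v - \<eta> * (norm a)\<^sup>2
      + \<eta> * ((norm b)\<^sup>2 + 2 * (e \<bullet> b) - (norm k)\<^sup>2) + \<rho> * (norm e)\<^sup>2"
    using k by (simp add: algebra_simps)
  also have "(norm b)\<^sup>2 + 2 * (e \<bullet> b) - (norm k)\<^sup>2 = - (norm e)\<^sup>2"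
    by (simp add: e_def power2_norm_eq_inner inner_diff_left inner_diff_right inner_commute)
  finally have "(\<eta> + \<alpha>) * (norm a)\<^sup>2 \<le> a \<bullet> v + (\<rho> - \<eta>) * (norm e)\<^sup>2"
    by (simp add: algebra_simps)
  also have "\<dots> \<le> a \<bullet> v" using rho_less by (simp add: mult_le_0_iff)
  finally show ?thesis .
qed

text \<open>The mirror image of \<open>N_fst_coercive\<close>: now \<open>a\<close> maximizes the
  negated form for fixed \<open>b\<close>.\<close>

lemma N_snd_coercive:
  assumes dom: "dominant_snd S \<eta> r \<alpha>" and N: "N (a, b) = (0, v)"
  shows "(\<eta> + \<alpha>) * (norm b)\<^sup>2 \<le> b \<bullet> v"
proof -
  obtain k where k: "\<alpha> * (norm b)\<^sup>2 \<le> - ((k, b) \<bullet> S (k, b)) - \<eta> * (norm k)\<^sup>2"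
    using dom unfolding dominant_snd_def by blast
  define e where "e = k - a"
  have S: "S (a, b) = (- \<eta> *\<^sub>R a, \<eta> *\<^sub>R b - v)"
  proof -
    have "flip_snd (S (a, b)) = (0, v) - \<eta> *\<^sub>R (a, b)"
      using N by (metis N_def add_diff_cancel_right')
    from arg_cong[OF this, of flip_snd] show ?thesis by simp
  qed
  have split: "(k, b) = (a, b) + (e, 0)" by (simp add: e_def)
  have "- ((k, b) \<bullet> S (k, b))
      = - ((a, b) \<bullet> S (a, b)) - 2 * ((e, 0) \<bullet> S (a, b)) - (e, 0) \<bullet> S (e, 0)"
    unfolding split linear_add[OF lin] inner_add_left inner_add_right
    using self[of "(a, b)" "(e, 0)"] by simp
  also have "\<dots> \<le> b \<bullet> v - \<eta> * (norm b)\<^sup>2 + \<eta> * (norm a)\<^sup>2 + 2 * \<eta> * (e \<bullet> a) + \<rho> * (norm e)\<^sup>2"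
    using fst_ge[of e]
    by (simp add: S inner_Pair inner_diff_right power2_norm_eq_inner algebra_simps)
  finally have "\<alpha> * (norm b)\<^sup>2 \<le> b \<bullet> v - \<eta> * (norm b)\<^sup>2
      + \<eta> * ((norm a)\<^sup>2 + 2 * (e \<bullet> a) - (norm k)\<^sup>2) + \<rho> * (norm e)\<^sup>2"
    using k by (simp add: algebra_simps)
  also have "(norm a)\<^sup>2 + 2 * (e \<bullet> a) - (norm k)\<^sup>2 = - (norm e)\<^sup>2"
    by (simp add: e_def power2_norm_eq_inner inner_diff_left inner_diff_right inner_commute)
  finally have "(\<eta> + \<alpha>) * (norm b)\<^sup>2 \<le> b \<bullet> v + (\<rho> - \<eta>) * (norm e)\<^sup>2"
    by (simp add: algebra_simps)
  also have "\<dots> \<le> b \<bullet> v" using rho_less by (simp add: mult_le_0_iff)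
  finally show ?thesis .
qed

text \<open>The right-hand side \<open>N w\<close> is split into its two components; by symmetry of \<open>S\<close> the cross
  terms cancel, and each remaining term is controlled by one of the two dominance conditions.\<close>

lemma N_cocoercive:
  assumes "dominant_fst S \<eta> r \<alpha>" "dominant_snd S \<eta> r \<alpha>" "0 < \<eta> + \<alpha>"
  shows "w \<bullet> N w \<le> (norm (N w))\<^sup>2 / (\<eta> + \<alpha>)"
proof -
  obtain v1 v2 where v: "N w = (v1, v2)" by force
  obtain a1 b1 where 1: "N (a1, b1) = (v1, 0)" using surj_N by (metis surjD surj_pair)
  obtain a2 b2 where 2: "N (a2, b2) = (0, v2)" using surj_N by (metis surjD surj_pair)
  have "N ((a1, b1) + (a2, b2)) = N w"
    unfolding linear_add[OF linear_N] 1 2 v by simp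
  then have w: "w = (a1, b1) + (a2, b2)" using inj_N by (metis injD)
  have "(a2, b2) \<bullet> flip_snd (N (a1, b1)) - \<eta> * ((a2, b2) \<bullet> flip_snd (a1, b1))
      = (a1, b1) \<bullet> flip_snd (N (a2, b2)) - \<eta> * ((a1, b1) \<bullet> flip_snd (a2, b2))"
    using self[of "(a2, b2)" "(a1, b1)"]
    by (simp add: N_def inner_prod_def inner_add_right algebra_simps)
  then have cross: "a2 \<bullet> v1 + b1 \<bullet> v2 = 0"
    unfolding 1 2 by (simp add: inner_commute algebra_simps)
  have "w \<bullet> N w = a1 \<bullet> v1 + b2 \<bullet> v2"
    using cross unfolding v unfolding w by (simp add: inner_add_left)
  also have "\<dots> \<le> (norm v1)\<^sup>2 / (\<eta> + \<alpha>) + (norm v2)\<^sup>2 / (\<eta> + \<alpha>)"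
    by (intro add_mono inner_le_if_strongly_monotone N_fst_coercive[OF assms(1) 1]
        N_snd_coercive[OF assms(2) 2] assms(3))
  finally show ?thesis by (simp add: v norm_Pair_power2 add_divide_distrib)
qed

lemma flip_snd_S: "flip_snd (S w) = N w - \<eta> *\<^sub>R w"
  by (simp add: N_def)

text \<open>Since \<open>flip_snd (S w) = N w - \<eta> *\<^sub>R w\<close>, the right-hand side is
  \<open>(norm (N w))\<^sup>2 - \<eta> * (w \<bullet> N w)\<close>, and cocoercivity bounds the
  subtracted term.\<close>

lemma N_strongly_monotone:
  assumes "dominant_fst S \<eta> r \<alpha>" "dominant_snd S \<eta> r \<alpha>" "0 < \<alpha>"
  shows "\<alpha> / (\<eta> + \<alpha>) * (norm (N w))\<^sup>2 \<le> N w \<bullet> flip_snd (S w)"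
proof -
  have pos: "0 < \<eta> + \<alpha>" using assms eta_pos by simp
  have "\<alpha> / (\<eta> + \<alpha>) * (norm (N w))\<^sup>2 = (norm (N w))\<^sup>2 - \<eta> * ((norm (N w))\<^sup>2 / (\<eta> + \<alpha>))"
    using pos by (simp add: field_simps)
  also have "\<dots> \<le> (norm (N w))\<^sup>2 - \<eta> * (w \<bullet> N w)"
    using mult_left_mono[OF N_cocoercive[OF assms(1,2) pos, of w], of \<eta>] eta_pos by linarith
  also have "\<dots> = N w \<bullet> flip_snd (S w)"
    by (simp add: flip_snd_S inner_diff_right power2_norm_eq_inner inner_commute)
  finally show ?thesis .
qed

text \<open>Expand the square: strong monotonicity controls the cross term and
  \<open>kappa_norm_le\<close> the quadratic one. For averaged Hessians the left-hand vector is
  \<open>\<eta>\<close> times the difference of two damped steps.\<close>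

lemma N_contraction:
  assumes "dominant_fst S \<eta> r \<alpha>" "dominant_snd S \<eta> r \<alpha>" "0 < \<alpha>" "0 \<le> l"
  shows "(norm (N w - l *\<^sub>R flip_snd (S w)))\<^sup>2
    \<le> (1 - 2 * l * (\<alpha> / (\<eta> + \<alpha>)) + l\<^sup>2 / kappa \<eta> \<rho>) * (norm (N w))\<^sup>2"
proof -
  let ?m = "flip_snd (S w)"
  have "kappa \<eta> \<rho> * (norm ?m)\<^sup>2 \<le> (norm (N w))\<^sup>2"
    using kappa_norm_le[OF monotone eta_pos rho_less, of w] by (simp add: N_def)
  then have "(norm ?m)\<^sup>2 \<le> (norm (N w))\<^sup>2 / kappa \<eta> \<rho>"
    using kappa_pos[OF eta_pos rho_less] by (simp add: field_simps)
  from mult_left_mono[OF this, of "l\<^sup>2"]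
  have lip: "l\<^sup>2 * (norm ?m)\<^sup>2 \<le> l\<^sup>2 / kappa \<eta> \<rho> * (norm (N w))\<^sup>2" by simp
  have "(norm (N w - l *\<^sub>R ?m))\<^sup>2 = (norm (N w))\<^sup>2 - 2 * l * (N w \<bullet> ?m) + l\<^sup>2 * (norm ?m)\<^sup>2"
    unfolding power2_norm_eq_inner
    by (simp add: inner_diff_left inner_diff_right inner_commute algebra_simps power2_eq_square)
  also have "\<dots> \<le> (norm (N w))\<^sup>2 - 2 * l * (\<alpha> / (\<eta> + \<alpha>) * (norm (N w))\<^sup>2)
      + l\<^sup>2 / kappa \<eta> \<rho> * (norm (N w))\<^sup>2"
    using mult_left_mono[OF N_strongly_monotone[OF assms(1-3), of w], of "2 * l"] assms(4) lip
    by linarith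
  finally show ?thesis by (simp add: algebra_simps)
qed

end

section \<open>Resolvents and the damped proximal iteration\<close>

text \<open>\<open>g\<close> is later the gradient of \<open>L\<close> and \<open>Hs\<close> its
  Hessian. The resolvent and its iteration depend on \<open>L\<close> only through these
  two.\<close>

locale hessian_field =
  fixes g :: "'a::euclidean_space \<times> 'b::euclidean_space \<Rightarrow> 'a \<times> 'b"
    and Hs :: "'a \<times> 'b \<Rightarrow> 'a \<times> 'b \<Rightarrow> 'a \<times> 'b" and \<rho> \<eta> \<beta> H :: real
  assumes deriv: "(g has_derivative Hs z) (at z)"
    and saddle: "saddle_operator (Hs z) \<rho> \<eta>"
    and bound: "norm (Hs z w) \<le> \<beta> * norm w"
    and lip: "norm (Hs z w - Hs z' w) \<le> H * norm (z - z') * norm w"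
    and beta_nonneg: "0 \<le> \<beta>" and H_nonneg: "0 \<le> H"
begin

section \<open>Averages of the Hessian over segments\<close>

lemma eta_pos: "0 < \<eta>" and rho_less: "\<rho> < \<eta>"
  using saddle by (auto simp: saddle_operator_def)

lemma continuous_on_Hs: "continuous_on A (\<lambda>z. Hs z w)"
proof -
  have "(H * norm w)-lipschitz_on A (\<lambda>z. Hs z w)"
    using lip H_nonneg by (intro lipschitz_onI) (auto simp: dist_norm ac_simps)
  then show ?thesis by (rule lipschitz_on_continuous_on)
qed

lemma lipschitz_g: "norm (g p - g q) \<le> \<beta> * norm (p - q)"
proof (rule differentiable_bound[of UNIV g Hs])
  show "onorm (Hs x) \<le> \<beta>" for x by (rule onorm_le) (rule bound)
qed (use deriv in auto)

definition averaged :: "'a \<times> 'b \<Rightarrow> 'a \<times> 'b \<Rightarrow> 'a \<times> 'b \<Rightarrow> 'a \<times> 'b" where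
  "averaged p q w = integral {0..1} (\<lambda>t. Hs (q + t *\<^sub>R (p - q)) w)"

lemma integrable_Hs: "(\<lambda>t. Hs (q + t *\<^sub>R (p - q)) w) integrable_on {0..1::real}"
  by (intro integrable_continuous_interval continuous_on_compose2[OF continuous_on_Hs[of UNIV]]
      continuous_intros) auto

lemma inner_averaged: "v \<bullet> averaged p q w = integral {0..1} (\<lambda>t. v \<bullet> Hs (q + t *\<^sub>R (p - q)) w)"
  using integral_linear[OF integrable_Hs bounded_linear_inner_right]
  by (simp add: averaged_def o_def)

lemma integrable_inner_Hs: "(\<lambda>t. v \<bullet> Hs (q + t *\<^sub>R (p - q)) w) integrable_on {0..1::real}"
  using integrable_linear[OF integrable_Hs bounded_linear_inner_right]
  by (simp add: o_def)

text \<open>Every condition of the locale is linear in the operator or a bound on one of its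
  quadratic forms, so integration over \<open>{0..1}\<close> preserves it.\<close>

lemma saddle_averaged: "saddle_operator (averaged p q) \<rho> \<eta>"
proof (rule saddle_operator.intro)
  have lin: "linear (Hs z)" for z using saddle[of z] by (simp add: saddle_operator_def)
  show "linear (averaged p q)"
    unfolding averaged_def
    by (intro linearI) (simp_all add: linear_add[OF lin] linear_scale[OF lin] integrable_Hs integral_add)
  show "v \<bullet> averaged p q w = w \<bullet> averaged p q v" for v w
    unfolding inner_averaged using saddle_operator.self[OF saddle] by metis
  show "- \<rho> * (norm a)\<^sup>2 \<le> (a, 0) \<bullet> averaged p q (a, 0)" for a
  proof -
    have "integral {0..1::real} (\<lambda>t. - \<rho> * (norm a)\<^sup>2)
        \<le> integral {0..1} (\<lambda>t. (a, 0) \<bullet> Hs (q + t *\<^sub>R (p - q)) (a, 0))"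
      by (intro integral_le integrable_inner_Hs integrable_const_ivl saddle_operator.fst_ge[OF saddle])
    then show ?thesis by (simp add: inner_averaged)
  qed
  show "(0, b) \<bullet> averaged p q (0, b) \<le> \<rho> * (norm b)\<^sup>2" for b
  proof -
    have "integral {0..1} (\<lambda>t. (0, b) \<bullet> Hs (q + t *\<^sub>R (p - q)) (0, b))
        \<le> integral {0..1::real} (\<lambda>t. \<rho> * (norm b)\<^sup>2)"
      by (intro integral_le integrable_inner_Hs integrable_const_ivl saddle_operator.snd_le[OF saddle])
    then show ?thesis by (simp add: inner_averaged)
  qed
qed (rule eta_pos rho_less)+

text \<open>The fundamental theorem of calculus along the segment. It gives an exact mean value
  identity for a vector-valued map.\<close>

lemma averaged_apply: "averaged p q (p - q) = g p - g q"
proof -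
  have "((\<lambda>t. Hs (q + t *\<^sub>R (p - q)) (p - q)) has_integral
      g (q + 1 *\<^sub>R (p - q)) - g (q + 0 *\<^sub>R (p - q))) {0..1::real}"
  proof (rule fundamental_theorem_of_calculus)
    fix t :: real
    have "((\<lambda>t. q + t *\<^sub>R (p - q)) has_derivative (\<lambda>t. t *\<^sub>R (p - q))) (at t within {0..1})"
      by (auto intro!: derivative_eq_intros)
    from has_derivative_compose[OF this deriv]
    show "((\<lambda>t. g (q + t *\<^sub>R (p - q))) has_vector_derivative Hs (q + t *\<^sub>R (p - q)) (p - q))
        (at t within {0..1})"
      using saddle[of "q + t *\<^sub>R (p - q)"]
      by (simp add: has_vector_derivative_def linear_scale saddle_operator_def)
  qed simp
  then show ?thesis by (simp add: averaged_def integral_unique)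
qed

lemma averaged_near:
  assumes "norm (p - z) \<le> R" "norm (q - z) \<le> R"
  shows "norm (averaged p q w - Hs z w) \<le> H * R * norm w"
proof -
  have "norm (Hs (q + t *\<^sub>R (p - q)) w - Hs z w) \<le> H * R * norm w" if "t \<in> {0..1}" for t
  proof -
    have "q + t *\<^sub>R (p - q) \<in> cball z R"
    proof -
      have "(1 - t) *\<^sub>R q + t *\<^sub>R p \<in> cball z R"
        by (rule convexD[OF convex_cball]) (use assms that in \<open>auto simp: dist_norm norm_minus_commute\<close>)
      then show ?thesis by (simp add: algebra_simps)
    qed
    then have "norm (q + t *\<^sub>R (p - q) - z) \<le> R" by (simp add: dist_norm norm_minus_commute)
    then show ?thesis
      by (intro order_trans[OF lip] mult_right_mono mult_left_mono H_nonneg) auto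
  qed
  then have "norm (integral {0..1::real} (\<lambda>t. Hs (q + t *\<^sub>R (p - q)) w - Hs z w))
      \<le> integral {0..1::real} (\<lambda>t. H * R * norm w)"
    by (intro integral_norm_bound_integral integrable_diff integrable_Hs integrable_const_ivl)
  also have "integral {0..1::real} (\<lambda>t. Hs (q + t *\<^sub>R (p - q)) w - Hs z w) = averaged p q w - Hs z w"
    by (subst integral_diff) (simp_all add: averaged_def integrable_Hs integrable_const_ivl)
  finally show ?thesis by simp
qed

lemma N_averaged:
  "saddle_operator.N (averaged p q) \<eta> (p - q) = flip_snd (g p) - flip_snd (g q) + \<eta> *\<^sub>R (p - q)"
  using saddle_operator.N_def[OF saddle_averaged]
  by (simp add: averaged_apply linear_diff[OF linear_flip_snd])

text \<open>A global statement about the nonlinear field, read off from the linear bound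
  \<open>N_monotone\<close> for the averaged operator.\<close>

lemma strongly_monotone:
  "(\<eta> - \<rho>) * (norm (p - q))\<^sup>2
    \<le> (p - q) \<bullet> (flip_snd (g p) - flip_snd (g q) + \<eta> *\<^sub>R (p - q))"
  using saddle_operator.N_monotone[OF saddle_averaged[of p q], of "p - q"] by (simp add: N_averaged)

text \<open>The field \<open>F\<close> is strongly monotone and Lipschitz, so a short step
  \<open>p - s *\<^sub>R F p\<close> is a contraction of the whole space, and its fixed points are
  the zeros of \<open>F\<close>.\<close>

lemma resolvent_ex1: "\<exists>!p. flip_snd (g p) + \<eta> *\<^sub>R (p - z) = 0"
proof -
  define F where "F p = flip_snd (g p) + \<eta> *\<^sub>R (p - z)" for p
  \<comment> \<open>Monotonicity and Lipschitz constants of \<open>F\<close>. The summand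
    \<open>\<bar>\<rho>\<bar>\<close> secures \<open>m \<le> l\<close> also for negative
    \<open>\<rho>\<close>.\<close>
  define m l where "m = \<eta> - \<rho>" and "l = \<beta> + \<eta> + \<bar>\<rho>\<bar>"
  have m: "0 < m" "m \<le> l" using rho_less beta_nonneg by (auto simp: m_def l_def)
  have F: "F p - F q = flip_snd (g p) - flip_snd (g q) + \<eta> *\<^sub>R (p - q)" for p q
    by (simp add: F_def algebra_simps)
  have mono: "m * (norm (p - q))\<^sup>2 \<le> (p - q) \<bullet> (F p - F q)" for p q
    using strongly_monotone[of p q] by (simp add: F m_def)
  have "norm (F p - F q) \<le> l * norm (p - q)" for p q
  proof -
    have "norm (F p - F q) \<le> norm (flip_snd (g p - g q)) + norm (\<eta> *\<^sub>R (p - q))"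
      unfolding F linear_diff[OF linear_flip_snd, symmetric] by (rule norm_triangle_ineq)
    also have "\<dots> \<le> \<beta> * norm (p - q) + \<eta> * norm (p - q) + \<bar>\<rho>\<bar> * norm (p - q)"
      using lipschitz_g[of p q] eta_pos by (simp add: add_increasing2)
    finally show ?thesis by (simp add: l_def algebra_simps)
  qed
  then have lipF: "(norm (F p - F q))\<^sup>2 \<le> l\<^sup>2 * (norm (p - q))\<^sup>2" for p q
    using power_mono[of "norm (F p - F q)" "l * norm (p - q)" 2] by (simp add: power_mult_distrib)
  \<comment> \<open>This \<open>s\<close> minimizes the squared factor
    \<open>1 - 2 * s * m + s\<^sup>2 * l\<^sup>2\<close>, and \<open>c\<close> is the
    minimum.\<close>
  define s c where "s = m / l\<^sup>2" and "c = 1 - (m / l)\<^sup>2"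
  have c: "0 \<le> c" "c < 1"
    using m by (auto simp: c_def power_le_one)
  have s: "0 < s" using m by (simp add: s_def)
  have sm: "1 - 2 * s * m + s\<^sup>2 * l\<^sup>2 = c"
    using m by (simp add: s_def c_def field_simps power2_eq_square)
  have "dist (p - s *\<^sub>R F p) (q - s *\<^sub>R F q) \<le> sqrt c * dist p q" for p q
  proof -
    have "(norm ((p - s *\<^sub>R F p) - (q - s *\<^sub>R F q)))\<^sup>2 = (norm ((p - q) - s *\<^sub>R (F p - F q)))\<^sup>2"
      by (simp add: algebra_simps)
    also have "\<dots> = (norm (p - q))\<^sup>2 - 2 * s * ((p - q) \<bullet> (F p - F q)) + s\<^sup>2 * (norm (F p - F q))\<^sup>2"
      unfolding power2_norm_eq_inner
      by (simp add: inner_diff_left inner_diff_right inner_commute algebra_simps power2_eq_square)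
    also have "\<dots> \<le> (norm (p - q))\<^sup>2 - 2 * s * (m * (norm (p - q))\<^sup>2) + s\<^sup>2 * (l\<^sup>2 * (norm (p - q))\<^sup>2)"
      using s by (intro add_mono diff_mono mult_left_mono mono lipF) auto
    also have "\<dots> = c * (norm (p - q))\<^sup>2" unfolding sm[symmetric] by (simp add: algebra_simps)
    finally have "sqrt ((norm ((p - s *\<^sub>R F p) - (q - s *\<^sub>R F q)))\<^sup>2) \<le> sqrt (c * (norm (p - q))\<^sup>2)"
      by (rule real_sqrt_le_mono)
    then show ?thesis by (simp add: dist_norm real_sqrt_mult)
  qed
  then have "\<exists>!p. p - s *\<^sub>R F p = p"
    using c by (intro banach_fix_type[of "sqrt c"]) auto
  then show ?thesis using s by (simp add: F_def)
qed

text \<open>The proximal operator, given by its optimality condition;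
  \<open>resolvent_eq_saddle_point\<close> identifies it with the saddle point.\<close>

definition resolvent :: "'a \<times> 'b \<Rightarrow> 'a \<times> 'b" where
  "resolvent z = (THE p. flip_snd (g p) + \<eta> *\<^sub>R (p - z) = 0)"

lemma resolvent_eq: "flip_snd (g (resolvent z)) = \<eta> *\<^sub>R (z - resolvent z)"
  using theI'[OF resolvent_ex1[of z]] unfolding resolvent_def[symmetric]
  by (simp add: algebra_simps eq_neg_iff_add_eq_0)

lemma resolvent_unique: "flip_snd (g p) + \<eta> *\<^sub>R (p - z) = 0 \<Longrightarrow> resolvent z = p"
  unfolding resolvent_def by (rule the1_equality[OF resolvent_ex1])

lemma resolvent_fixed_iff: "resolvent z = z \<longleftrightarrow> g z = 0"
proof
  assume "resolvent z = z"
  with resolvent_eq[of z] have "flip_snd (g z) = 0" by simp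
  then show "g z = 0" by (metis norm_eq_zero norm_flip_snd)
next
  assume "g z = 0"
  then show "resolvent z = z" by (intro resolvent_unique) (simp add: linear_0[OF linear_flip_snd])
qed

text \<open>Strong monotonicity between \<open>resolvent z\<close> and \<open>z\<close>, where the
  proximal field has the values \<open>0\<close> and \<open>flip_snd (g z)\<close>.\<close>

lemma resolvent_displacement: "norm (resolvent z - z) \<le> norm (g z) / (\<eta> - \<rho>)"
proof -
  have "(\<eta> - \<rho>) * (norm (resolvent z - z))\<^sup>2 \<le> (resolvent z - z) \<bullet> (- flip_snd (g z))"
    using strongly_monotone[of "resolvent z" z] by (simp add: resolvent_eq algebra_simps)
  from norm_le_if_strongly_monotone[OF this] rho_less show ?thesis by simp
qed

section \<open>The damped step and its displacement\<close>

definition step :: "real \<Rightarrow> 'a \<times> 'b \<Rightarrow> 'a \<times> 'b" where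
  "step l z = (1 - l) *\<^sub>R z + l *\<^sub>R resolvent z"

text \<open>Averaging the Hessian over the segment between two resolvents expresses both \<open>z - z'\<close> and
  the difference of the displacements through one operator of saddle type, without
  differentiating the resolvent.\<close>

lemma resolvent_averaged:
  fixes z z'
  defines "p \<equiv> resolvent z" and "q \<equiv> resolvent z'"
  shows "saddle_operator.N (averaged p q) \<eta> (p - q) = \<eta> *\<^sub>R (z - z')"
    and "flip_snd (averaged p q (p - q)) = \<eta> *\<^sub>R ((z - p) - (z' - q))"
  by (simp_all add: N_averaged averaged_apply linear_diff[OF linear_flip_snd] p_def q_def
      resolvent_eq algebra_simps)

definition dominant :: "real \<Rightarrow> real \<Rightarrow> ('a \<times> 'b \<Rightarrow> 'a \<times> 'b) \<Rightarrow> bool" where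
  "dominant r \<alpha> S \<longleftrightarrow> dominant_fst S \<eta> r \<alpha> \<and> dominant_snd S \<eta> r \<alpha>"

text \<open>\<open>N_contraction\<close> for the averaged operator at the difference of the
  resolvents, divided by \<open>\<eta>\<^sup>2\<close>.\<close>

lemma step_contraction:
  assumes "dominant r \<alpha> (averaged (resolvent z) (resolvent z'))" "0 < \<alpha>" "0 \<le> l"
  shows "(norm (step l z - step l z'))\<^sup>2
    \<le> (1 - 2 * l * (\<alpha> / (\<eta> + \<alpha>)) + l\<^sup>2 / kappa \<eta> \<rho>) * (norm (z - z'))\<^sup>2"
proof -
  have eq: "\<eta> *\<^sub>R (z - z') - l *\<^sub>R \<eta> *\<^sub>R ((z - resolvent z) - (z' - resolvent z'))
      = \<eta> *\<^sub>R (step l z - step l z')"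
    by (simp add: step_def algebra_simps)
  show ?thesis
    using saddle_operator.N_contraction[OF saddle_averaged,
        of "resolvent z" "resolvent z'" r \<alpha> l "resolvent z - resolvent z'"] assms eta_pos
    unfolding resolvent_averaged eq dominant_def
    by (simp add: power_mult_distrib mult.left_commute)
qed

lemma displacement_strongly_monotone:
  assumes "dominant r \<alpha> (averaged (resolvent z) (resolvent z'))" "0 < \<alpha>"
  shows "\<alpha> / (\<eta> + \<alpha>) * (norm (z - z'))\<^sup>2
    \<le> (z - z') \<bullet> ((z - resolvent z) - (z' - resolvent z'))"
proof -
  have "\<eta>\<^sup>2 * (\<alpha> / (\<eta> + \<alpha>) * (norm (z - z'))\<^sup>2)
      \<le> \<eta>\<^sup>2 * ((z - z') \<bullet> ((z - resolvent z) - (z' - resolvent z')))"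
    using saddle_operator.N_strongly_monotone[OF saddle_averaged,
        of "resolvent z" "resolvent z'" r \<alpha> "resolvent z - resolvent z'"] assms eta_pos
    unfolding resolvent_averaged dominant_def
    by (simp add: power_mult_distrib power2_eq_square mult.left_commute mult.assoc)
  then show ?thesis using eta_pos by (subst (asm) mult_le_cancel_left_pos) simp_all
qed

section \<open>Persistence of dominance and convergence in a ball around \<open>z0\<close>\<close>

lemma dominant_averaged:
  assumes "dominant r \<alpha> (Hs z)" "norm (p - z) \<le> R" "norm (q - z) \<le> R"
  shows "dominant r (\<alpha> - H * R * (1 + r\<^sup>2)) (averaged p q)"
proof -
  have "0 \<le> H * R" using assms(2) H_nonneg by (meson mult_nonneg_nonneg norm_ge_zero order_trans)
  then show ?thesis
    using assms averaged_near[OF assms(2,3)] unfolding dominant_def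
    by (auto intro: dominant_fst_perturbation dominant_snd_perturbation)
qed

text \<open>\<open>G\<close> bounds the displacement at \<open>z0\<close>, and the Lipschitz
  gradient adds at most \<open>\<beta> * R / (\<eta> - \<rho>)\<close> for other points of the ball.
  The result is the radius within which Hessians have to be compared.\<close>

lemma resolvent_near:
  assumes "norm (g z0) \<le> (\<eta> - \<rho>) * G" "norm (z - z0) \<le> R"
  shows "norm (resolvent z - z0) \<le> G + R + \<beta> * R / (\<eta> - \<rho>)"
proof -
  have "norm (g z) \<le> norm (g z0) + norm (g z - g z0)" by (rule norm_triangle_sub)
  also have "\<dots> \<le> (\<eta> - \<rho>) * G + \<beta> * R"
    using assms by (intro add_mono order_trans[OF lipschitz_g] mult_left_mono beta_nonneg)
  finally have "norm (g z) / (\<eta> - \<rho>) \<le> ((\<eta> - \<rho>) * G + \<beta> * R) / (\<eta> - \<rho>)"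
    using rho_less by (intro divide_right_mono) auto
  also have "\<dots> = G + \<beta> * R / (\<eta> - \<rho>)" using rho_less by (simp add: add_divide_distrib)
  finally have "norm (resolvent z - z) \<le> G + \<beta> * R / (\<eta> - \<rho>)"
    using resolvent_displacement[of z] by linarith
  moreover have "norm (resolvent z - z0) \<le> norm (resolvent z - z) + norm (z - z0)"
    using norm_triangle_ineq[of "resolvent z - z" "z - z0"] by simp
  ultimately show ?thesis using assms(2) by linarith
qed

text \<open>Zeros of \<open>g\<close> are the fixed points of every step with nonzero damping, so a
  damping convenient for Banach's theorem on the ball of radius \<open>2 * d\<close> may be chosen.
  Strong monotonicity of the displacement afterwards halves the radius.\<close>

lemma ex_zero_near:
  assumes dom: "\<And>z z'. norm (z - z0) \<le> 2 * d \<Longrightarrow> norm (z' - z0) \<le> 2 * d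
      \<Longrightarrow> dominant r \<alpha> (averaged (resolvent z) (resolvent z'))"
    and "0 < \<alpha>" "0 \<le> d" and disp: "norm (resolvent z0 - z0) \<le> \<alpha> / (\<eta> + \<alpha>) * d"
  shows "\<exists>zs. g zs = 0 \<and> norm (zs - z0) \<le> d"
proof -
  define c where "c = \<alpha> / (\<eta> + \<alpha>)"
  have c: "0 < c" "c \<le> 1" using \<open>0 < \<alpha>\<close> eta_pos by (auto simp: c_def)
  define \<kappa> where "\<kappa> = kappa \<eta> \<rho>"
  have \<kappa>: "0 < \<kappa>" "\<kappa> \<le> 1" using kappa_pos[OF eta_pos rho_less] kappa_le_1 by (auto simp: \<kappa>_def)
  have cc: "c\<^sup>2 * \<kappa> \<le> 1" using c \<kappa> by (simp add: mult_le_one power_le_one)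
  \<comment> \<open>The minimizer of the squared contraction factor
    \<open>1 - 2 * s * c + s\<^sup>2 / \<kappa>\<close>, whose minimum is
    \<open>1 - c\<^sup>2 * \<kappa>\<close>.\<close>
  define s where "s = c * \<kappa>"
  have s: "0 < s" using c \<kappa> by (simp add: s_def)
  define q where "q = sqrt (1 - c\<^sup>2 * \<kappa>)"
  have q: "0 \<le> q" "q < 1" using cc c \<kappa> by (auto simp: q_def)
  \<comment> \<open>With \<open>x = c\<^sup>2 * \<kappa>\<close> this gives
    \<open>sqrt (1 - x) \<le> 1 - x / 2\<close>.\<close>
  have "(1 - x / 2)\<^sup>2 = 1 - x + (x / 2)\<^sup>2" for x :: real by (simp add: power2_eq_square algebra_simps)
  then have q_le: "q \<le> 1 - c\<^sup>2 * \<kappa> / 2"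
    unfolding q_def using cc by (intro real_le_lsqrt) auto
  have contr: "norm (step s z - step s z') \<le> q * norm (z - z')"
    if "norm (z - z0) \<le> 2 * d" "norm (z' - z0) \<le> 2 * d" for z z'
  proof -
    have "1 - 2 * s * c + s\<^sup>2 / \<kappa> = 1 - c\<^sup>2 * \<kappa>"
      using \<kappa> by (simp add: s_def field_simps power2_eq_square)
    with step_contraction[OF dom[OF that] \<open>0 < \<alpha>\<close>, of s, folded c_def \<kappa>_def] s
    have "(norm (step s z - step s z'))\<^sup>2 \<le> (1 - c\<^sup>2 * \<kappa>) * (norm (z - z'))\<^sup>2"
      by (metis less_imp_le)
    from real_sqrt_le_mono[OF this] show ?thesis by (simp add: real_sqrt_mult q_def)
  qed
  have "\<exists>!z\<in>cball z0 (2 * d). step s z = z"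
  proof (rule Banach_fix[OF _ _ q])
    \<comment> \<open>The contraction gains \<open>c\<^sup>2 * \<kappa> * d\<close> on the radius
      \<open>2 * d\<close>, exactly as much as the movement \<open>s * (c * d)\<close> of the center
      costs.\<close>
    show "step s ` cball z0 (2 * d) \<subseteq> cball z0 (2 * d)"
    proof
      fix y assume "y \<in> step s ` cball z0 (2 * d)"
      then obtain z where z: "norm (z - z0) \<le> 2 * d" and y: "y = step s z"
        by (auto simp: dist_norm norm_minus_commute)
      have "norm (y - z0) \<le> norm (step s z - step s z0) + norm (step s z0 - z0)"
        using norm_triangle_ineq[of "step s z - step s z0" "step s z0 - z0"] by (simp add: y)
      also have "step s z0 - z0 = s *\<^sub>R (resolvent z0 - z0)" by (simp add: step_def algebra_simps)
      also have "norm (step s z - step s z0) + norm \<dots> \<le> q * (2 * d) + s * (c * d)"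
        using contr[OF z, of z0] mult_left_mono[OF z q(1)] mult_left_mono[OF disp, of s] s \<open>0 \<le> d\<close>
        by (simp add: c_def)
      also have "\<dots> \<le> (1 - c\<^sup>2 * \<kappa> / 2) * (2 * d) + s * (c * d)"
        using \<open>0 \<le> d\<close> by (intro add_right_mono mult_right_mono q_le) auto
      also have "\<dots> = 2 * d" by (simp add: s_def algebra_simps power2_eq_square)
      finally show "y \<in> cball z0 (2 * d)" by (simp add: dist_norm norm_minus_commute)
    qed
    show "dist (step s x) (step s y) \<le> q * dist x y"
      if "x \<in> cball z0 (2 * d)" "y \<in> cball z0 (2 * d)" for x y
      using contr that by (simp add: dist_norm norm_minus_commute)
  qed (use \<open>0 \<le> d\<close> in \<open>auto simp: complete_eq_closed\<close>)
  then obtain zs where zs: "norm (zs - z0) \<le> 2 * d" "step s zs = zs"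
    by (auto simp: dist_norm norm_minus_commute)
  have "s *\<^sub>R (resolvent zs - zs) = 0" using zs(2) by (simp add: step_def algebra_simps)
  then have res: "resolvent zs = zs" using s by simp
  \<comment> \<open>The displacement at \<open>zs\<close> vanishes, so strong monotonicity bounds
    the distance from \<open>z0\<close> by the displacement at \<open>z0\<close> over
    \<open>c\<close>.\<close>
  have "c * (norm (z0 - zs))\<^sup>2 \<le> (z0 - zs) \<bullet> (z0 - resolvent z0)"
    using displacement_strongly_monotone[OF dom[of z0 zs] \<open>0 < \<alpha>\<close>] zs(1) \<open>0 \<le> d\<close>
    by (simp add: res c_def)
  then have "norm (z0 - zs) \<le> norm (z0 - resolvent z0) / c"
    by (rule norm_le_if_strongly_monotone) (rule c)
  also have "\<dots> \<le> d" using disp c unfolding c_def[symmetric] by (simp add: norm_minus_commute field_simps)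
  finally have "norm (zs - z0) \<le> d" by (simp add: norm_minus_commute)
  then show ?thesis using res resolvent_fixed_iff by blast
qed

text \<open>The rate is at least \<open>(1 - l / C)\<^sup>2\<close>, because
  \<open>kappa \<eta> \<rho> \<le> 1 \<le> C\<^sup>2\<close>.\<close>

lemma rate_nonneg:
  assumes "1 \<le> C"
  shows "0 \<le> 1 - 2 * l / C + l\<^sup>2 / kappa \<eta> \<rho>"
proof -
  have \<kappa>: "0 < kappa \<eta> \<rho>" "kappa \<eta> \<rho> \<le> 1"
    using kappa_pos[OF eta_pos rho_less] kappa_le_1 by auto
  have "0 \<le> (1 - l / C)\<^sup>2" by simp
  also have "\<dots> = 1 - 2 * l / C + l\<^sup>2 / C\<^sup>2" using assms by (simp add: field_simps power2_eq_square)
  also have "l\<^sup>2 / C\<^sup>2 \<le> l\<^sup>2 / kappa \<eta> \<rho>"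
    using assms \<kappa> by (intro divide_left_mono) (auto intro: order_trans[OF \<kappa>(2)] one_le_power)
  finally show ?thesis by simp
qed

text \<open>By \<open>radius\<close>, at least half of \<open>\<alpha>0\<close> survives at the
  resolvents of a ball around \<open>z0\<close>. A zero of \<open>g\<close> lies within half the
  radius of that ball, and contraction towards it keeps all iterates inside.\<close>

theorem damped_resolvent_converges:
  assumes dom: "dominant r \<alpha>0 (Hs z0)" and "0 < \<alpha>0"
    and g0: "norm (g z0) \<le> (\<eta> - \<rho>) * G"
    and R: "R = 4 * sqrt 2 * (\<eta> + \<alpha>0 / 2) / \<alpha>0 * G"
    and radius: "H * (G + R + \<beta> * R / (\<eta> - \<rho>)) * (1 + r\<^sup>2) \<le> \<alpha>0 / 2"
    and l: "0 < l" "l \<le> 2 * (kappa \<eta> \<rho> / (2 * \<eta> / \<alpha>0 + 1))"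
    and z: "z 0 = z0" "\<And>k. z (Suc k) = step l (z k)"
  shows "\<exists>zs. g zs = 0 \<and> norm (zs - z0) \<le> R \<and> linearly_converges z zs \<and>
    (\<forall>k. (norm (z k - zs))\<^sup>2
      \<le> (1 - 2 * l / (2 * \<eta> / \<alpha>0 + 1) + l\<^sup>2 / kappa \<eta> \<rho>) ^ k * (norm (z0 - zs))\<^sup>2)"
proof -
  \<comment> \<open>\<open>1 / C\<close> is the value of
    \<open>\<alpha> / (\<eta> + \<alpha>)\<close> at
    \<open>\<alpha> = \<alpha>0 / 2\<close>.\<close>
  define C where "C = 2 * \<eta> / \<alpha>0 + 1"
  have C: "1 \<le> C" using eta_pos \<open>0 < \<alpha>0\<close> by (simp add: C_def)
  define rate where "rate = 1 - 2 * l / C + l\<^sup>2 / kappa \<eta> \<rho>"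
  have rate: "0 \<le> rate" unfolding rate_def by (rule rate_nonneg[OF C])
  have \<kappa>: "0 < kappa \<eta> \<rho>" using kappa_pos[OF eta_pos rho_less] .
  have "0 \<le> (\<eta> - \<rho>) * G" using g0 norm_ge_zero order_trans by blast
  then have G: "0 \<le> G" using rho_less by (simp add: zero_le_mult_iff)
  have R_nonneg: "0 \<le> R" unfolding R using G eta_pos \<open>0 < \<alpha>0\<close> by (intro mult_nonneg_nonneg divide_nonneg_nonneg) auto
  have main: "\<exists>zs. g zs = 0 \<and> norm (zs - z0) \<le> R \<and> linearly_converges z zs \<and>
    (\<forall>k. (norm (z k - zs))\<^sup>2 \<le> rate ^ k * (norm (z0 - zs))\<^sup>2)"
  proof (cases "G = 0")
    \<comment> \<open>Here the start is already stationary and the iteration constant. The other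
      case relies on \<open>2 * d < R\<close>, which is strict only for positive
      \<open>G\<close>.\<close>
    case True
    then have "g z0 = 0" using g0 by simp
    then have "resolvent z0 = z0" by (simp add: resolvent_fixed_iff)
    then have "z k = z0" for k
      by (induction k) (simp_all add: z step_def algebra_simps)
    then have const: "z = (\<lambda>k. z0)" by auto
    then have "linearly_converges z z0"
      unfolding linearly_converges_def by (auto intro!: exI[of _ "0::real"])
    with \<open>g z0 = 0\<close> R_nonneg
    have "g z0 = 0 \<and> norm (z0 - z0) \<le> R \<and> linearly_converges z z0 \<and>
        (\<forall>k. (norm (z k - z0))\<^sup>2 \<le> rate ^ k * (norm (z0 - z0))\<^sup>2)"
      by (simp add: const)
    then show ?thesis by blast
  next
    case False
    with G have "0 < G" by simp
    \<comment> \<open>Equals \<open>C * G\<close>, so that the displacement at \<open>z0\<close>, at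
      most \<open>G\<close>, meets the requirement of \<open>ex_zero_near\<close>.\<close>
    define d where "d = 2 * (\<eta> + \<alpha>0 / 2) / \<alpha>0 * G"
    have d: "0 < d" using \<open>0 < G\<close> \<open>0 < \<alpha>0\<close> eta_pos by (simp add: d_def)
    have Rd: "R = 2 * sqrt 2 * d" by (simp add: R d_def)
    have "2 * d * 1 < 2 * d * sqrt 2" using d by (intro mult_strict_left_mono) auto
    then have "2 * d < R" by (simp add: Rd ac_simps)
    with d have dR: "2 * d < R" "d \<le> R" by simp_all
    define R1 where "R1 = G + 2 * d + \<beta> * (2 * d) / (\<eta> - \<rho>)"
    define \<alpha> where "\<alpha> = \<alpha>0 - H * R1 * (1 + r\<^sup>2)"
    text \<open>The factor \<open>\<surd>2\<close> to spare in \<open>R\<close> makes this strict, hence linear convergence also for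
      the largest admissible damping, where the asserted rate equals \<open>1\<close>.\<close>
    have \<alpha>: "\<alpha>0 / 2 < \<alpha>"
    proof (cases "H = 0")
      case True
      then show ?thesis using \<open>0 < \<alpha>0\<close> by (simp add: \<alpha>_def)
    next
      case False
      with H_nonneg have "0 < H" by simp
      have "\<beta> * (2 * d) / (\<eta> - \<rho>) \<le> \<beta> * R / (\<eta> - \<rho>)"
        using dR beta_nonneg rho_less by (intro divide_right_mono mult_left_mono) auto
      then have "R1 < G + R + \<beta> * R / (\<eta> - \<rho>)"
        using dR unfolding R1_def by linarith
      then have "H * R1 * (1 + r\<^sup>2) < H * (G + R + \<beta> * R / (\<eta> - \<rho>)) * (1 + r\<^sup>2)"
        using \<open>0 < H\<close> by (intro mult_strict_right_mono mult_strict_left_mono) (auto simp: add_pos_nonneg)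
      from order.strict_trans2[OF this radius] show ?thesis unfolding \<alpha>_def by linarith
    qed
    with \<open>0 < \<alpha>0\<close> have "0 < \<alpha>" by simp
    have near: "dominant r \<alpha> (averaged (resolvent y) (resolvent y'))"
      if "norm (y - z0) \<le> 2 * d" "norm (y' - z0) \<le> 2 * d" for y y'
      unfolding \<alpha>_def R1_def
      using dominant_averaged[OF dom resolvent_near[OF g0 that(1)] resolvent_near[OF g0 that(2)]] .
    define c where "c = \<alpha> / (\<eta> + \<alpha>)"
    have c_gt: "1 / C < c"
      using \<alpha> \<open>0 < \<alpha>0\<close> \<open>0 < \<alpha>\<close> eta_pos by (simp add: C_def c_def field_simps)
    have d_eq: "d = C * G" using \<open>0 < \<alpha>0\<close> by (simp add: d_def C_def add_divide_distrib)
    have "norm (resolvent z0 - z0) \<le> norm (g z0) / (\<eta> - \<rho>)" by (rule resolvent_displacement)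
    also have "\<dots> \<le> G" using g0 rho_less by (simp add: field_simps)
    also have "G = 1 / C * d" using C by (simp add: d_eq)
    also have "\<dots> \<le> c * d" using c_gt d by (intro mult_right_mono) auto
    finally have "\<exists>zs. g zs = 0 \<and> norm (zs - z0) \<le> d"
      unfolding c_def by (intro ex_zero_near[OF near \<open>0 < \<alpha>\<close> less_imp_le[OF d]])
    then obtain zs where zs: "g zs = 0" "norm (zs - z0) \<le> d" by blast
    have fix_zs: "step l zs = zs"
      using zs(1) by (simp add: step_def resolvent_fixed_iff[symmetric] algebra_simps)
    \<comment> \<open>The rate that is actually attained, with \<open>c\<close> in place of the
      smaller \<open>1 / C\<close>.\<close>
    define rate' where "rate' = 1 - 2 * l * c + l\<^sup>2 / kappa \<eta> \<rho>"
    have "rate' = 1 - 2 * l / (1 / c) + l\<^sup>2 / kappa \<eta> \<rho>" by (simp add: rate'_def)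
    also have "0 \<le> \<dots>"
      by (rule rate_nonneg) (use \<open>0 < \<alpha>\<close> eta_pos in \<open>auto simp: c_def field_simps\<close>)
    finally have rate'_nonneg: "0 \<le> rate'" by simp
    have "2 * l * (1 / C) \<le> 2 * l * c" using c_gt l by (intro mult_left_mono) auto
    then have rate'_le: "rate' \<le> rate" by (simp add: rate_def rate'_def)
    \<comment> \<open>The bound on the damping gives \<open>l / kappa \<eta> \<rho> < 2 * c\<close>,
      which says precisely that \<open>rate'\<close> is below \<open>1\<close>.\<close>
    have "l / kappa \<eta> \<rho> \<le> 2 * (1 / C)" using l(2) C \<kappa> unfolding C_def[symmetric] by (simp add: field_simps)
    also have "\<dots> < 2 * c" using c_gt by simp
    finally have "l * (l / kappa \<eta> \<rho>) < l * (2 * c)" using l(1) by (rule mult_strict_left_mono)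
    then have rate'_less: "rate' < 1" by (simp add: rate'_def power2_eq_square)
    \<comment> \<open>The bound by \<open>d\<close> is carried along because, with \<open>zs\<close>
      within \<open>d\<close> of \<open>z0\<close>, it keeps \<open>z k\<close> in the ball of
      radius \<open>2 * d\<close> on which dominance is known.\<close>
    have bound: "norm (z k - zs) \<le> d \<and> (norm (z k - zs))\<^sup>2 \<le> rate' ^ k * (norm (z0 - zs))\<^sup>2" for k
    proof (induction k)
      case 0
      then show ?case using zs by (simp add: z norm_minus_commute)
    next
      case (Suc k)
      have "norm (z k - z0) \<le> 2 * d"
        using Suc zs(2) norm_triangle_ineq[of "z k - zs" "zs - z0"] by simp
      from step_contraction[OF near[OF this, of zs] \<open>0 < \<alpha>\<close>, of l]
      have le: "(norm (z (Suc k) - zs))\<^sup>2 \<le> rate' * (norm (z k - zs))\<^sup>2"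
        using l zs(2) d by (simp add: z fix_zs rate'_def c_def)
      also have "\<dots> \<le> rate' * (rate' ^ k * (norm (z0 - zs))\<^sup>2)"
        using Suc rate'_nonneg by (intro mult_left_mono) auto
      finally have 1: "(norm (z (Suc k) - zs))\<^sup>2 \<le> rate' ^ Suc k * (norm (z0 - zs))\<^sup>2" by simp
      have "rate' * (norm (z k - zs))\<^sup>2 \<le> 1 * (norm (z k - zs))\<^sup>2"
        using rate'_less by (intro mult_right_mono) auto
      with le have "norm (z (Suc k) - zs) \<le> norm (z k - zs)"
        by (intro power2_le_imp_le[OF _ norm_ge_zero]) linarith
      with 1 Suc show ?case by simp
    qed
    have "norm (z k - zs) \<le> norm (z0 - zs) * sqrt rate' ^ k" for k
    proof -
      have "sqrt ((norm (z k - zs))\<^sup>2) \<le> sqrt (rate' ^ k * (norm (z0 - zs))\<^sup>2)"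
        using bound by (intro real_sqrt_le_mono) auto
      then show ?thesis by (simp add: real_sqrt_mult real_sqrt_power mult.commute)
    qed
    then have "linearly_converges z zs"
      unfolding linearly_converges_def
      using rate'_nonneg rate'_less by (intro exI[of _ "norm (z0 - zs)"] exI[of _ "sqrt rate'"]) auto
    moreover have "(norm (z k - zs))\<^sup>2 \<le> rate ^ k * (norm (z0 - zs))\<^sup>2" for k
      using bound[of k] power_mono[OF rate'_le rate'_nonneg, of k]
      by (meson mult_right_mono order_trans zero_le_power2)
    ultimately show ?thesis using zs dR by (intro exI[of _ zs]) auto
  qed
  then show ?thesis unfolding rate_def C_def .
qed

end

section \<open>Gradients, Hessians and saddle points\<close>

lemma gderiv_unique: "GDERIV f z :> u \<Longrightarrow> GDERIV f z :> v \<Longrightarrow> u = v"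
  unfolding gderiv_def by (metis has_derivative_unique vector_eq_ldot)

lemma gderiv_grad:
  fixes f :: "'a::euclidean_space \<Rightarrow> real"
  assumes "f differentiable (at z)"
  shows "GDERIV f z :> grad f z"
proof -
  obtain D where D: "(f has_derivative D) (at z)" using assms by (auto simp: differentiable_def)
  have "D = (\<lambda>h. h \<bullet> adjoint D 1)"
    using adjoint_works[OF has_derivative_linear[OF D], of _ 1] by auto
  with D have "GDERIV f z :> adjoint D 1" unfolding gderiv_def by simp
  then show ?thesis unfolding grad_def by (rule theI) (metis gderiv_unique \<open>GDERIV f z :> adjoint D 1\<close>)
qed

text \<open>The mean value theorem is applied first in direction \<open>u\<close> to the increment
  along \<open>v\<close>, then in direction \<open>v\<close> to the gradient. The left-hand side of
  the identity is symmetric in \<open>u\<close> and \<open>v\<close>, whence the symmetry of the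
  Hessian.\<close>

lemma second_difference:
  fixes f :: "'a::real_inner \<Rightarrow> real"
  assumes f: "\<And>z. GDERIV f z :> g z" and g: "\<And>z. (g has_derivative Hs z) (at z)" and t: "0 < t"
  shows "\<exists>x. norm (x - z) \<le> t * (norm u + norm v) \<and>
    f (z + t *\<^sub>R u + t *\<^sub>R v) - f (z + t *\<^sub>R u) - f (z + t *\<^sub>R v) + f z = t\<^sup>2 * (u \<bullet> Hs x v)"
proof -
  have f': "(f has_derivative (\<lambda>h. h \<bullet> g x)) (at x)" for x
    using f by (simp add: gderiv_def)
  define \<phi> where "\<phi> s = f (z + s *\<^sub>R u + t *\<^sub>R v) - f (z + s *\<^sub>R u)" for s
  have "(\<phi> has_derivative (\<lambda>h. (h *\<^sub>R u) \<bullet> g (z + s *\<^sub>R u + t *\<^sub>R v) - (h *\<^sub>R u) \<bullet> g (z + s *\<^sub>R u)))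
      (at s within {0..t})" for s
    unfolding \<phi>_def by (intro derivative_intros has_derivative_compose[OF _ f'])
      (auto intro!: derivative_eq_intros)
  from mvt_simple[OF t this] obtain s where s: "s \<in> {0<..<t}"
    and \<phi>: "\<phi> t - \<phi> 0 = t * (u \<bullet> (g (z + s *\<^sub>R u + t *\<^sub>R v) - g (z + s *\<^sub>R u)))"
    by (auto simp: inner_diff_right algebra_simps)
  define \<psi> where "\<psi> r = u \<bullet> g (z + s *\<^sub>R u + r *\<^sub>R v)" for r
  have "(\<psi> has_derivative (\<lambda>h. u \<bullet> Hs (z + s *\<^sub>R u + r *\<^sub>R v) (h *\<^sub>R v))) (at r within {0..t})" for r
    unfolding \<psi>_def by (intro derivative_intros has_derivative_compose[OF _ g])
      (auto intro!: derivative_eq_intros)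
  from mvt_simple[OF t this] obtain r where r: "r \<in> {0<..<t}"
    and \<psi>: "\<psi> t - \<psi> 0 = t * (u \<bullet> Hs (z + s *\<^sub>R u + r *\<^sub>R v) v)"
    by (auto simp: linear_scale[OF has_derivative_linear[OF g]])
  have "norm (s *\<^sub>R u + r *\<^sub>R v) \<le> t * (norm u + norm v)"
    using s r norm_triangle_ineq[of "s *\<^sub>R u" "r *\<^sub>R v"]
      mult_right_mono[of s t "norm u"] mult_right_mono[of r t "norm v"]
    by (simp add: algebra_simps)
  moreover have "f (z + t *\<^sub>R u + t *\<^sub>R v) - f (z + t *\<^sub>R u) - f (z + t *\<^sub>R v) + f z = \<phi> t - \<phi> 0"
    by (simp add: \<phi>_def)
  moreover have "\<dots> = t\<^sup>2 * (u \<bullet> Hs (z + s *\<^sub>R u + r *\<^sub>R v) v)"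
    using \<phi> \<psi> by (simp add: \<psi>_def inner_diff_right power2_eq_square)
  ultimately show ?thesis
    by (intro exI[of _ "z + s *\<^sub>R u + r *\<^sub>R v"]) (simp add: add.assoc)
qed

text \<open>Evaluating the second difference in both orders gives equal values of the form at two
  points near \<open>z\<close>. The Lipschitz bound moves both points to \<open>z\<close> at a cost
  of order \<open>t\<close>, and \<open>t\<close> is arbitrary.\<close>

lemma hessian_symmetric:
  fixes f :: "'a::real_inner \<Rightarrow> real"
  assumes f: "\<And>z. GDERIV f z :> g z" and g: "\<And>z. (g has_derivative Hs z) (at z)"
    and lip: "\<And>z w h. norm (Hs z h - Hs w h) \<le> H * norm (z - w) * norm h" and "0 \<le> H"
  shows "u \<bullet> Hs z v = v \<bullet> Hs z u"
proof -
  define K where "K = 2 * (H * (norm u + norm v) * norm u * norm v)"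
  have K: "0 \<le> K" using \<open>0 \<le> H\<close> by (simp add: K_def)
  have near: "\<bar>u \<bullet> Hs x v - u \<bullet> Hs z v\<bar> \<le> t * (H * (norm u + norm v) * norm u * norm v)"
    if "norm (x - z) \<le> t * (norm u + norm v)" for t x u v
  proof -
    have "\<bar>u \<bullet> Hs x v - u \<bullet> Hs z v\<bar> \<le> norm u * norm (Hs x v - Hs z v)"
      unfolding inner_diff_right[symmetric] by (rule Cauchy_Schwarz_ineq2)
    also have "\<dots> \<le> norm u * (H * (t * (norm u + norm v)) * norm v)"
      using that \<open>0 \<le> H\<close>
      by (intro mult_left_mono order_trans[OF lip] mult_right_mono) auto
    finally show ?thesis by (simp add: algebra_simps)
  qed
  have le: "\<bar>u \<bullet> Hs z v - v \<bullet> Hs z u\<bar> \<le> t * K" if t: "0 < t" for t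
  proof -
    obtain x where x: "norm (x - z) \<le> t * (norm u + norm v)"
      "f (z + t *\<^sub>R u + t *\<^sub>R v) - f (z + t *\<^sub>R u) - f (z + t *\<^sub>R v) + f z = t\<^sup>2 * (u \<bullet> Hs x v)"
      using second_difference[OF f g t] by blast
    obtain y where y: "norm (y - z) \<le> t * (norm v + norm u)"
      "f (z + t *\<^sub>R v + t *\<^sub>R u) - f (z + t *\<^sub>R v) - f (z + t *\<^sub>R u) + f z = t\<^sup>2 * (v \<bullet> Hs y u)"
      using second_difference[OF f g t] by blast
    have "t\<^sup>2 * (u \<bullet> Hs x v) = t\<^sup>2 * (v \<bullet> Hs y u)"
      unfolding x(2)[symmetric] y(2)[symmetric] by (simp add: algebra_simps)
    then have "u \<bullet> Hs x v = v \<bullet> Hs y u" using t by simp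
    then show ?thesis
      using near[OF x(1)] near[OF y(1)] by (simp add: K_def algebra_simps)
  qed
  have "\<bar>u \<bullet> Hs z v - v \<bullet> Hs z u\<bar> \<le> 0 + e" if "0 < e" for e
  proof -
    \<comment> \<open>The choice \<open>t = e / (K + 1)\<close>, where adding \<open>1\<close>
      covers \<open>K = 0\<close>.\<close>
    have "\<bar>u \<bullet> Hs z v - v \<bullet> Hs z u\<bar> \<le> e / (K + 1) * K"
      using that K by (intro le) auto
    also have "\<dots> \<le> e" using that K by (simp add: field_simps)
    finally show ?thesis by simp
  qed
  then have "\<bar>u \<bullet> Hs z v - v \<bullet> Hs z u\<bar> \<le> 0" by (rule field_le_epsilon)
  then show ?thesis by simp
qed

section \<open>Saddle points as zeros of a monotone field\<close>

lemma local_extremum_gradient_zero: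
  assumes "(f has_derivative (\<lambda>h. h \<bullet> d)) (at x)" "local_minimizer f x \<or> local_maximizer f x"
  shows "d = 0"
proof -
  obtain S where "open S" "x \<in> S" "(\<forall>y\<in>S. f y \<le> f x) \<or> (\<forall>y\<in>S. f x \<le> f y)"
    using assms(2) unfolding local_minimizer_def local_maximizer_def eventually_nhds by blast
  then have "(\<lambda>h. h \<bullet> d) = (\<lambda>h. 0)"
    by (intro differential_zero_maxmin[OF _ _ assms(1)])
  then have "d \<bullet> d = 0" by meson
  then show ?thesis by simp
qed

lemma has_derivative_partial_fst:
  fixes F :: "'a::real_inner \<times> 'b::real_inner \<Rightarrow> real"
  assumes "(F has_derivative (\<lambda>h. h \<bullet> d)) (at (x, y))"
  shows "((\<lambda>u. F (u, y)) has_derivative (\<lambda>h. h \<bullet> fst d)) (at x within A)"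
proof -
  have "((\<lambda>u. (u, y)) has_derivative (\<lambda>h. (h, 0))) (at x within A)"
    by (auto intro!: derivative_eq_intros)
  from has_derivative_compose[OF this assms] show ?thesis by (simp add: inner_prod_def)
qed

lemma has_derivative_partial_snd:
  fixes F :: "'a::real_inner \<times> 'b::real_inner \<Rightarrow> real"
  assumes "(F has_derivative (\<lambda>h. h \<bullet> d)) (at (x, y))"
  shows "((\<lambda>v. F (x, v)) has_derivative (\<lambda>h. h \<bullet> snd d)) (at y within A)"
proof -
  have "((\<lambda>v. (x, v)) has_derivative (\<lambda>h. (0, h))) (at y within A)"
    by (auto intro!: derivative_eq_intros)
  from has_derivative_compose[OF this assms] show ?thesis by (simp add: inner_prod_def)
qed

lemma local_minimizer_if_global: "(\<And>u. f x \<le> f u) \<Longrightarrow> local_minimizer f x"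
  and local_maximizer_if_global: "(\<And>u. f u \<le> f x) \<Longrightarrow> local_maximizer f x"
  by (simp_all add: local_minimizer_def local_maximizer_def)

text \<open>A saddle point is extremal in each component, so both partial gradients vanish.
  Conversely, at a zero \<open>p\<close> monotonicity gives
  \<open>h \<bullet> D (p + t *\<^sub>R h)\<close> a sign, and the mean value theorem turns it into
  both saddle inequalities; \<open>flip_snd\<close> reverses the one in the second
  component.\<close>

lemma strongly_monotone_saddle_iff:
  fixes F :: "'a::real_inner \<times> 'b::real_inner \<Rightarrow> real"
  assumes F: "\<And>z. (F has_derivative (\<lambda>h. h \<bullet> flip_snd (D z))) (at z)"
    and mono: "\<And>p q. m * (norm (p - q))\<^sup>2 \<le> (p - q) \<bullet> (D p - D q)" and "0 < m"
  shows "saddle_point F p \<longleftrightarrow> D p = 0"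
proof -
  obtain x y where p: "p = (x, y)" by force
  show ?thesis
  proof
    assume "saddle_point F p"
    then have "local_minimizer (\<lambda>u. F (u, y)) x" "local_maximizer (\<lambda>v. F (x, v)) y"
      by (auto simp: saddle_point_def p local_minimizer_if_global local_maximizer_if_global)
    then have "fst (flip_snd (D p)) = 0 \<and> snd (flip_snd (D p)) = 0"
      using local_extremum_gradient_zero[OF has_derivative_partial_fst[OF F]]
        local_extremum_gradient_zero[OF has_derivative_partial_snd[OF F]]
      unfolding p by blast
    then show "D p = 0" by (simp add: prod_eq_iff)
  next
    assume D: "D p = 0"
    have along: "0 \<le> h \<bullet> D (p + t *\<^sub>R h)" if "0 < t" for t h
    proof -
      have "0 \<le> m * (norm (t *\<^sub>R h))\<^sup>2" using \<open>0 < m\<close> by simp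
      also have "\<dots> \<le> t * (h \<bullet> D (p + t *\<^sub>R h))"
        using mono[of "p + t *\<^sub>R h" p] D by simp
      finally show ?thesis using that by (simp add: zero_le_mult_iff)
    qed
    have diff: "\<exists>t>0. F (p + h) - F p = h \<bullet> flip_snd (D (p + t *\<^sub>R h))" for h
    proof -
      have "((\<lambda>t. F (p + t *\<^sub>R h)) has_derivative (\<lambda>s. (s *\<^sub>R h) \<bullet> flip_snd (D (p + t *\<^sub>R h))))
          (at t within {0..1})" for t :: real
        by (rule has_derivative_compose[OF _ F]) (auto intro!: derivative_eq_intros)
      from mvt_simple[OF zero_less_one this] show ?thesis by auto
    qed
    have "F p \<le> F (u, y)" for u
    proof -
      obtain t where "0 < t" "F (p + (u - x, 0)) - F p
          = (u - x, 0) \<bullet> flip_snd (D (p + t *\<^sub>R (u - x, 0)))"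
        using diff by blast
      then show ?thesis using along[of t "(u - x, 0)"] by (simp add: p inner_prod_def)
    qed
    moreover have "F (x, v) \<le> F p" for v
    proof -
      obtain t where "0 < t" "F (p + (0, v - y)) - F p
          = (0, v - y) \<bullet> flip_snd (D (p + t *\<^sub>R (0, v - y)))"
        using diff by blast
      then show ?thesis using along[of t "(0, v - y)"] by (simp add: p inner_prod_def)
    qed
    ultimately show "saddle_point F p" by (simp add: saddle_point_def p)
  qed
qed

lemma has_derivative_proximal_objective:
  fixes L :: "'a::real_inner \<times> 'b::real_inner \<Rightarrow> real"
  assumes "GDERIV L p :> g"
  shows "((\<lambda>(u, v). L (u, v) + \<eta> / 2 * (norm (u - fst z))\<^sup>2 - \<eta> / 2 * (norm (v - snd z))\<^sup>2)
    has_derivative (\<lambda>h. h \<bullet> flip_snd (flip_snd g + \<eta> *\<^sub>R (p - z)))) (at p)"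
proof -
  have L: "(L has_derivative (\<lambda>h. h \<bullet> g)) (at p)" using assms by (simp add: gderiv_def)
  have "((\<lambda>p. L p + \<eta> / 2 * ((fst p - fst z) \<bullet> (fst p - fst z))
        - \<eta> / 2 * ((snd p - snd z) \<bullet> (snd p - snd z)))
      has_derivative (\<lambda>h. h \<bullet> flip_snd (flip_snd g + \<eta> *\<^sub>R (p - z)))) (at p)"
    by (rule derivative_eq_intros L refl)+
      (simp add: fun_eq_iff inner_prod_def inner_diff_right inner_add_right inner_commute
        algebra_simps)
  then show ?thesis by (simp add: case_prod_beta' power2_norm_eq_inner)
qed

lemma (in hessian_field) resolvent_eq_saddle_point:
  assumes "\<And>z. GDERIV L z :> g z"
  shows "resolvent z = (THE p. saddle_point
    (\<lambda>(u, v). L (u, v) + \<eta> / 2 * (norm (u - fst z))\<^sup>2 - \<eta> / 2 * (norm (v - snd z))\<^sup>2) p)"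
proof -
  have "(p - q) \<bullet> ((flip_snd (g p) + \<eta> *\<^sub>R (p - z)) - (flip_snd (g q) + \<eta> *\<^sub>R (q - z)))
      = (p - q) \<bullet> (flip_snd (g p) - flip_snd (g q) + \<eta> *\<^sub>R (p - q))" for p q
    by (simp add: algebra_simps)
  then show ?thesis
    unfolding resolvent_def
    using strongly_monotone_saddle_iff[OF has_derivative_proximal_objective[OF assms], of "\<eta> - \<rho>"]
      strongly_monotone rho_less by simp
qed

section \<open>Matrices\<close>

lemma matrix_mult_vec: "linear f \<Longrightarrow> matrix f *v x = f x" for f :: "real^'n \<Rightarrow> real^'m"
  using fun_cong[OF matrix_vector_mul(2)] .

lemma mat_mult_vec: "(mat c :: real^'n^'n) *v v = c *\<^sub>R v"
  using matrix_mult_vec[OF linear_compose_scale_right[OF linear_ident], of c v]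
  by (simp add: matrix_scaleR)

lemma loewner_ge_mat_iff: "A \<succeq> mat c \<longleftrightarrow> (\<forall>v. c * (norm v)\<^sup>2 \<le> v \<bullet> (A *v v))"
  by (simp add: loewner_ge_def matrix_vector_mult_diff_rdistrib mat_mult_vec inner_diff_right
      power2_norm_eq_inner)

lemma uminus_mult_vec: "(- A) *v v = - (A *v (v :: real^'n))"
  using matrix_vector_mult_diff_rdistrib[of 0 A v] by simp

lemma norm_mult_vec_le: "norm (A *v v) \<le> opnorm A * norm v"
  unfolding opnorm_def by (rule onorm) simp

text \<open>Coercivity forces injectivity, hence invertibility of the square matrix, so that
  \<open>matrix_inv\<close> is a genuine inverse.\<close>

lemma matrix_inv_coercive:
  fixes Q :: "real^'n^'n"
  assumes Q: "\<And>v. m * (norm v)\<^sup>2 \<le> v \<bullet> (Q *v v)" and m: "0 < m"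
  shows "Q *v (matrix_inv Q *v u) = u" and "norm (matrix_inv Q *v u) \<le> norm u / m"
proof -
  have "v = 0" if "Q *v v = 0" for v
    using norm_le_if_strongly_monotone[OF Q m, of v] that by simp
  then have "inj ((*v) Q)" by (simp add: linear_injective_0)
  then have "invertible Q" by (simp add: invertible_left_inverse matrix_left_invertible_injective)
  then have "Q ** matrix_inv Q = mat 1"
    unfolding invertible_def matrix_inv_def by (rule someI2_ex) blast
  then show inv: "Q *v (matrix_inv Q *v u) = u"
    by (simp add: matrix_vector_mul_assoc)
  show "norm (matrix_inv Q *v u) \<le> norm u / m"
    using norm_le_if_strongly_monotone[OF Q m, of "matrix_inv Q *v u"] by (simp add: inv)
qed

text \<open>The left-hand side is a lower bound for
  \<open>2 * (w \<bullet> u) - w \<bullet> (Q *v w)\<close> at the trial vector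
  \<open>w = (1 / c) *\<^sub>R u\<close>, while the maximum of this expression over all
  \<open>w\<close> is the right-hand side.\<close>

lemma inner_matrix_inv_ge:
  fixes Q :: "real^'n^'n"
  assumes Q: "\<And>v. m * (norm v)\<^sup>2 \<le> v \<bullet> (Q *v v)" and m: "0 < m"
    and sym: "\<And>u v. u \<bullet> (Q *v v) = v \<bullet> (Q *v u)"
    and le: "\<And>v. v \<bullet> (Q *v v) \<le> c * (norm v)\<^sup>2" and c: "0 < c"
  shows "(norm u)\<^sup>2 / c \<le> u \<bullet> (matrix_inv Q *v u)"
proof -
  define k w where "k = matrix_inv Q *v u" and "w = (1 / c) *\<^sub>R u"
  have k: "Q *v k = u" unfolding k_def by (rule matrix_inv_coercive(1)[OF Q m])
  have "0 \<le> m * (norm (k - w))\<^sup>2" using m by simp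
  also have "\<dots> \<le> (k - w) \<bullet> (Q *v (k - w))" by (rule Q)
  also have "\<dots> = k \<bullet> u - 2 * (w \<bullet> u) + w \<bullet> (Q *v w)"
    using sym[of k w] by (simp add: k matrix_vector_mult_diff_distrib inner_diff_left
        inner_diff_right inner_commute)
  also have "\<dots> \<le> k \<bullet> u - 2 * (w \<bullet> u) + c * (norm w)\<^sup>2" by (intro add_left_mono le)
  also have "\<dots> = k \<bullet> u - (norm u)\<^sup>2 / c"
  proof -
    have "w \<bullet> u = (norm u)\<^sup>2 / c" by (simp add: w_def power2_norm_eq_inner)
    moreover have "c * (norm w)\<^sup>2 = (norm u)\<^sup>2 / c"
      using c by (simp add: w_def power_divide power2_eq_square[of c])
    ultimately show ?thesis by simp
  qed
  finally show ?thesis by (simp add: k_def inner_commute)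
qed

text \<open>The quadratic form attains its minimum \<open>c\<close> on the compact unit sphere. A
  minimizer is an eigenvector and no eigenvalue is below \<open>c\<close>, so the
  \<open>LEAST\<close> in the definition exists and equals \<open>c\<close>.\<close>

lemma lambda_min_le:
  fixes A :: "real^'n^'n"
  assumes sym: "\<And>u v. u \<bullet> (A *v v) = v \<bullet> (A *v u)"
  shows "lambda_min A * (norm v)\<^sup>2 \<le> v \<bullet> (A *v v)"
proof -
  let ?f = "\<lambda>v. v \<bullet> (A *v v)"
  have "continuous_on (sphere 0 1) ?f"
    by (intro continuous_intros linear_continuous_on) simp
  then obtain v0 where v0: "norm v0 = 1" and min: "\<And>v. norm v = 1 \<Longrightarrow> ?f v0 \<le> ?f v"
    using continuous_attains_inf[of "sphere 0 1" ?f] by auto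
  define c where "c = ?f v0"
  have c_le: "c * (norm v)\<^sup>2 \<le> ?f v" for v
  proof (cases "v = 0")
    case False
    then have "c \<le> ?f ((1 / norm v) *\<^sub>R v)" unfolding c_def by (intro min) simp
    also have "\<dots> = ?f v / (norm v)\<^sup>2"
      by (simp add: matrix_vector_mult_scaleR power2_eq_square)
    finally show ?thesis using False by (simp add: field_simps)
  qed simp
  have "A *v v0 = c *\<^sub>R v0"
  proof -
    \<comment> \<open>Moving \<open>v0\<close> against the residual \<open>D\<close> lowers the
      nonnegative form by \<open>2 * s * (norm D)\<^sup>2\<close> to first order, while the
      second-order term is only \<open>s * (s * K)\<close>. Small \<open>s\<close> thus forces
      \<open>D = 0\<close>.\<close>
    define D K where "D = A *v v0 - c *\<^sub>R v0" and "K = ?f D - c * (norm D)\<^sup>2"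
    have K: "0 \<le> K" unfolding K_def using c_le by simp
    have le: "2 * (norm D)\<^sup>2 \<le> s * K" if "0 < s" for s
    proof -
      have "0 \<le> ?f (v0 - s *\<^sub>R D) - c * (norm (v0 - s *\<^sub>R D))\<^sup>2" using c_le by simp
      also have "\<dots> = s * (s * K) - s * (2 * (norm D)\<^sup>2)"
      proof -
        have 1: "?f (v0 - s *\<^sub>R D) = c - 2 * s * (D \<bullet> (A *v v0)) + s * (s * ?f D)"
          using sym[of v0 D] by (simp add: c_def matrix_vector_mult_diff_distrib
              matrix_vector_mult_scaleR inner_diff_left inner_diff_right algebra_simps)
        have 2: "(norm (v0 - s *\<^sub>R D))\<^sup>2 = 1 - 2 * s * (D \<bullet> v0) + s * (s * (norm D)\<^sup>2)"
          using v0 unfolding power2_norm_eq_inner norm_eq_1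
          by (simp add: inner_diff_left inner_diff_right inner_commute algebra_simps)
        have 3: "D \<bullet> (A *v v0) = (norm D)\<^sup>2 + c * (D \<bullet> v0)"
          by (simp add: D_def power2_norm_eq_inner inner_diff_left inner_diff_right inner_commute algebra_simps)
        show ?thesis unfolding 1 2 3 K_def by (simp add: algebra_simps)
      qed
      finally have "s * (2 * (norm D)\<^sup>2) \<le> s * (s * K)" by simp
      with that show ?thesis by simp
    qed
    have "D = 0"
    proof (rule ccontr)
      assume "D \<noteq> 0"
      then have "2 * (norm D)\<^sup>2 \<le> (norm D)\<^sup>2 / (K + 1) * K"
        using K by (intro le) auto
      also have "\<dots> \<le> (norm D)\<^sup>2" using K by (simp add: field_simps)
      finally show False using \<open>D \<noteq> 0\<close> by simp
    qed
    then show ?thesis by (simp add: D_def)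
  qed
  then have "is_eigenvalue A c" using v0 by (auto simp: is_eigenvalue_def intro!: exI[of _ v0])
  moreover have "c \<le> d" if "is_eigenvalue A d" for d
  proof -
    obtain v where "v \<noteq> 0" "A *v v = d *\<^sub>R v" using \<open>is_eigenvalue A d\<close> by (auto simp: is_eigenvalue_def)
    then show ?thesis using c_le[of v] by (simp add: power2_norm_eq_inner)
  qed
  ultimately have "lambda_min A = c" unfolding lambda_min_def by (rule Least_equality)
  then show ?thesis using c_le by simp
qed

section \<open>Interaction dominance\<close>

lemma hess_apply:
  assumes "linear (hess L z)"
  shows "hess L z (a, b) = (hess_xx L z *v a + hess_xy L z *v b, hess_yx L z *v a + hess_yy L z *v b)"
proof -
  have 1: "linear (\<lambda>h::real^'a. (h, 0 :: real^'b))" and 2: "linear (\<lambda>h::real^'b. (0 :: real^'a, h))"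
    by (auto intro!: linearI)
  note fst = bounded_linear.linear[OF bounded_linear_fst] and snd = bounded_linear.linear[OF bounded_linear_snd]
  have "hess_xx L z *v a = fst (hess L z (a, 0))" "hess_yx L z *v a = snd (hess L z (a, 0))"
    "hess_xy L z *v b = fst (hess L z (0, b))" "hess_yy L z *v b = snd (hess L z (0, b))"
    unfolding hess_xx_def hess_xy_def hess_yx_def hess_yy_def
    using linear_compose[OF linear_compose[OF 1 assms] fst] linear_compose[OF linear_compose[OF 1 assms] snd]
      linear_compose[OF linear_compose[OF 2 assms] fst] linear_compose[OF linear_compose[OF 2 assms] snd]
    by (simp_all add: matrix_mult_vec o_def)
  then show ?thesis
    using linear_add[OF assms, of "(a, 0)" "(0, b)"] by (simp add: prod_eq_iff)
qed

locale saddle_hessian = saddle_operator "hess L z" \<rho> \<eta>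
  for L :: "(real^'n) \<times> (real^'m) \<Rightarrow> real" and z \<rho> \<eta>
begin

lemmas blocks = hess_apply[OF lin]

lemma inner_xx: "u \<bullet> (hess_xx L z *v v) = v \<bullet> (hess_xx L z *v u)"
  using self[of "(u, 0)" "(v, 0)"] by (simp add: blocks inner_Pair)

lemma inner_yy: "u \<bullet> (hess_yy L z *v v) = v \<bullet> (hess_yy L z *v u)"
  using self[of "(0, u)" "(0, v)"] by (simp add: blocks inner_Pair)

lemma inner_xy: "u \<bullet> (hess_xy L z *v v) = v \<bullet> (hess_yx L z *v u)"
  using self[of "(u, 0)" "(0, v)"] by (simp add: blocks inner_Pair)

text \<open>\<open>hess_yx\<close> is the transpose of \<open>hess_xy\<close>, and the bound passes
  over by duality:
  \<open>(norm (B\<^sup>T a))\<^sup>2 = a \<bullet> B (B\<^sup>T a)\<close>.\<close>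

lemma norm_yx_le:
  assumes "opnorm (hess_xy L z) \<le> \<delta>"
  shows "norm (hess_yx L z *v a) \<le> \<delta> * norm a"
proof (cases "hess_yx L z *v a = 0")
  case True
  have "0 \<le> \<delta>" using assms onorm_pos_le[OF matrix_vector_mul_bounded_linear] unfolding opnorm_def by (rule order_trans[rotated])
  then show ?thesis using True by simp
next
  case False
  let ?u = "hess_yx L z *v a"
  have "norm ?u * norm ?u = a \<bullet> (hess_xy L z *v ?u)"
    by (simp add: inner_xy power2_norm_eq_inner[symmetric] power2_eq_square[symmetric])
  also have "\<dots> \<le> norm a * norm (hess_xy L z *v ?u)" by (rule norm_cauchy_schwarz)
  also have "\<dots> \<le> norm a * (\<delta> * norm ?u)"
    using assms by (intro mult_left_mono order_trans[OF norm_mult_vec_le] mult_right_mono) auto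
  finally show ?thesis using False by (simp add: ac_simps)
qed

lemma coercive_xx: "(\<eta> - \<rho>) * (norm v)\<^sup>2 \<le> v \<bullet> ((mat \<eta> + hess_xx L z) *v v)"
  using fst_ge[of v] by (simp add: blocks inner_Pair matrix_vector_mult_add_rdistrib mat_mult_vec
      inner_add_right power2_norm_eq_inner algebra_simps)

lemma coercive_yy: "(\<eta> - \<rho>) * (norm v)\<^sup>2 \<le> v \<bullet> ((mat \<eta> - hess_yy L z) *v v)"
  using snd_le[of v] by (simp add: blocks inner_Pair matrix_vector_mult_diff_rdistrib mat_mult_vec
      inner_diff_right power2_norm_eq_inner algebra_simps)

lemma interaction_dominant_iff:
  "interaction_dominant L \<eta> z \<alpha> \<longleftrightarrow>
    (\<forall>a. \<alpha> * (norm a)\<^sup>2 \<le> a \<bullet> (hess_xx L z *v a)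
      + (hess_yx L z *v a) \<bullet> (matrix_inv (mat \<eta> - hess_yy L z) *v (hess_yx L z *v a))) \<and>
    (\<forall>b. \<alpha> * (norm b)\<^sup>2 \<le> - (b \<bullet> (hess_yy L z *v b))
      + (hess_xy L z *v b) \<bullet> (matrix_inv (mat \<eta> + hess_xx L z) *v (hess_xy L z *v b)))"
  unfolding interaction_dominant_def loewner_ge_mat_iff
  by (simp add: matrix_vector_mult_add_rdistrib matrix_vector_mult_diff_rdistrib uminus_mult_vec
      inner_add_right inner_diff_right inner_xy inner_xy[symmetric] matrix_vector_mul_assoc[symmetric] inner_commute)

text \<open>The maximizer \<open>Q\<^sup>-\<^sup>1 B\<^sup>T a\<close> itself serves as witness. Its
  size is bounded by \<open>\<delta>\<close> for the cross block and
  \<open>1 / (\<eta> - \<rho>)\<close> for the inverse.\<close>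

lemma interaction_dominant_imp:
  assumes "interaction_dominant L \<eta> z \<alpha>" and \<delta>: "opnorm (hess_xy L z) \<le> \<delta>"
  shows "dominant_fst (hess L z) \<eta> (\<delta> / (\<eta> - \<rho>)) \<alpha>"
    and "dominant_snd (hess L z) \<eta> (\<delta> / (\<eta> - \<rho>)) \<alpha>"
proof -
  have m: "0 < \<eta> - \<rho>" using rho_less by simp
  show "dominant_fst (hess L z) \<eta> (\<delta> / (\<eta> - \<rho>)) \<alpha>"
    unfolding dominant_fst_def
  proof
    fix a
    define k where "k = matrix_inv (mat \<eta> - hess_yy L z) *v (hess_yx L z *v a)"
    have k: "(mat \<eta> - hess_yy L z) *v k = hess_yx L z *v a"
      and "norm k \<le> norm (hess_yx L z *v a) / (\<eta> - \<rho>)"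
      unfolding k_def by (rule matrix_inv_coercive[OF coercive_yy m])+
    with norm_yx_le[OF \<delta>, of a] m have "norm k \<le> \<delta> / (\<eta> - \<rho>) * norm a"
      by (simp add: field_simps)
    moreover have "\<eta> * (norm k)\<^sup>2 = k \<bullet> (hess_yx L z *v a) + k \<bullet> (hess_yy L z *v k)"
      unfolding k[symmetric] by (simp add: matrix_vector_mult_diff_rdistrib mat_mult_vec
          inner_diff_right power2_norm_eq_inner)
    moreover have "\<alpha> * (norm a)\<^sup>2 \<le> a \<bullet> (hess_xx L z *v a) + (hess_yx L z *v a) \<bullet> k"
      using assms(1) unfolding interaction_dominant_iff k_def by blast
    ultimately show "\<exists>b. norm b \<le> \<delta> / (\<eta> - \<rho>) * norm a \<and>
        \<alpha> * (norm a)\<^sup>2 \<le> (a, b) \<bullet> hess L z (a, b) - \<eta> * (norm b)\<^sup>2"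
      by (intro exI[of _ k]) (simp add: blocks inner_Pair inner_add_right inner_xy inner_commute)
  qed
  show "dominant_snd (hess L z) \<eta> (\<delta> / (\<eta> - \<rho>)) \<alpha>"
    unfolding dominant_snd_def
  proof
    fix b
    \<comment> \<open>In this half the witness is \<open>- k\<close>, since the negated form has the
      cross term with a minus sign.\<close>
    define k where "k = matrix_inv (mat \<eta> + hess_xx L z) *v (hess_xy L z *v b)"
    have k: "(mat \<eta> + hess_xx L z) *v k = hess_xy L z *v b"
      and "norm k \<le> norm (hess_xy L z *v b) / (\<eta> - \<rho>)"
      unfolding k_def by (rule matrix_inv_coercive[OF coercive_xx m])+
    moreover have "norm (hess_xy L z *v b) \<le> \<delta> * norm b"
      using \<delta> by (intro order_trans[OF norm_mult_vec_le] mult_right_mono) auto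
    ultimately have "norm (- k) \<le> \<delta> / (\<eta> - \<rho>) * norm b"
      using m by (simp add: field_simps)
    moreover have "\<eta> * (norm k)\<^sup>2 = k \<bullet> (hess_xy L z *v b) - k \<bullet> (hess_xx L z *v k)"
      unfolding k[symmetric] by (simp add: matrix_vector_mult_add_rdistrib mat_mult_vec
          inner_add_right power2_norm_eq_inner)
    moreover have "\<alpha> * (norm b)\<^sup>2 \<le> - (b \<bullet> (hess_yy L z *v b)) + (hess_xy L z *v b) \<bullet> k"
      using assms(1) unfolding interaction_dominant_iff k_def by blast
    ultimately show "\<exists>a. norm a \<le> \<delta> / (\<eta> - \<rho>) * norm b \<and>
        \<alpha> * (norm b)\<^sup>2 \<le> - ((a, b) \<bullet> hess L z (a, b)) - \<eta> * (norm a)\<^sup>2"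
      by (intro exI[of _ "- k"]) (simp add: blocks inner_Pair inner_add_right inner_diff_right inner_xy[symmetric]
          inner_commute linear_neg[OF matrix_vector_mul_linear])
  qed
qed

text \<open>The matrices to be inverted are at most \<open>\<eta> + \<beta>\<close>, so the forms of
  their inverses are at least \<open>1 / (\<eta> + \<beta>)\<close>. Composed with the cross block,
  this leaves \<open>lambda_min\<close> of its product with the transpose.\<close>

lemma interaction_dominant_if:
  assumes \<beta>: "\<And>w. norm (hess L z w) \<le> \<beta> * norm w" and "0 \<le> \<beta>"
    and xx: "\<And>a. c * (norm a)\<^sup>2 \<le> a \<bullet> (hess_xx L z *v a)"
    and yy: "\<And>b. d * (norm b)\<^sup>2 \<le> - (b \<bullet> (hess_yy L z *v b))"
    and x: "\<alpha> \<le> c + lambda_min (hess_xy L z ** hess_yx L z) / (\<eta> + \<beta>)"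
    and y: "\<alpha> \<le> d + lambda_min (hess_yx L z ** hess_xy L z) / (\<eta> + \<beta>)"
  shows "interaction_dominant L \<eta> z \<alpha>"
  unfolding interaction_dominant_iff
proof (intro conjI allI)
  have m: "0 < \<eta> - \<rho>" using rho_less by simp
  have \<eta>\<beta>: "0 < \<eta> + \<beta>" using eta_pos \<open>0 \<le> \<beta>\<close> by simp
  have bnd: "\<bar>w \<bullet> hess L z w\<bar> \<le> \<beta> * (norm w)\<^sup>2" for w
    using inner_perturbation[where S' = "hess L z" and S = "\<lambda>_. 0" and e = \<beta> and w = w] \<beta> by simp
  have 1: "\<bar>v \<bullet> (hess_xx L z *v v)\<bar> \<le> \<beta> * (norm v)\<^sup>2" for v
    using bnd[of "(v, 0)"] by (simp add: blocks inner_Pair norm_Pair_power2)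
  have 2: "\<bar>v \<bullet> (hess_yy L z *v v)\<bar> \<le> \<beta> * (norm v)\<^sup>2" for v
    using bnd[of "(0, v)"] by (simp add: blocks inner_Pair norm_Pair_power2)
  show "\<alpha> * (norm a)\<^sup>2 \<le> a \<bullet> (hess_xx L z *v a)
      + (hess_yx L z *v a) \<bullet> (matrix_inv (mat \<eta> - hess_yy L z) *v (hess_yx L z *v a))" for a
  proof -
    let ?B = "hess_xy L z ** hess_yx L z"
    let ?u = "hess_yx L z *v a"
    have "lambda_min ?B * (norm a)\<^sup>2 \<le> a \<bullet> (?B *v a)"
      by (rule lambda_min_le) (simp add: matrix_vector_mul_assoc[symmetric] inner_xy inner_commute)
    also have "\<dots> = (norm ?u)\<^sup>2"
      by (simp add: matrix_vector_mul_assoc[symmetric] inner_xy power2_norm_eq_inner)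
    finally have "lambda_min ?B / (\<eta> + \<beta>) * (norm a)\<^sup>2 \<le> (norm ?u)\<^sup>2 / (\<eta> + \<beta>)"
      using divide_right_mono[OF _ less_imp_le[OF \<eta>\<beta>]] by fastforce
    also have "\<dots> \<le> ?u \<bullet> (matrix_inv (mat \<eta> - hess_yy L z) *v ?u)"
    proof (rule inner_matrix_inv_ge[OF coercive_yy m _ _ \<eta>\<beta>])
      show "u \<bullet> ((mat \<eta> - hess_yy L z) *v v) = v \<bullet> ((mat \<eta> - hess_yy L z) *v u)" for u v
        using inner_yy[of u v] by (simp add: matrix_vector_mult_diff_rdistrib mat_mult_vec
            inner_diff_right inner_commute)
      show "v \<bullet> ((mat \<eta> - hess_yy L z) *v v) \<le> (\<eta> + \<beta>) * (norm v)\<^sup>2" for v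
        using 2[of v] by (simp add: matrix_vector_mult_diff_rdistrib mat_mult_vec
            inner_diff_right power2_norm_eq_inner algebra_simps abs_le_iff)
    qed
    finally show ?thesis
      using xx[of a] mult_right_mono[OF x, of "(norm a)\<^sup>2"] by (simp add: algebra_simps)
  qed
  show "\<alpha> * (norm b)\<^sup>2 \<le> - (b \<bullet> (hess_yy L z *v b))
      + (hess_xy L z *v b) \<bullet> (matrix_inv (mat \<eta> + hess_xx L z) *v (hess_xy L z *v b))" for b
  proof -
    let ?B = "hess_yx L z ** hess_xy L z"
    let ?u = "hess_xy L z *v b"
    have "lambda_min ?B * (norm b)\<^sup>2 \<le> b \<bullet> (?B *v b)"
      by (rule lambda_min_le)
        (simp add: matrix_vector_mul_assoc[symmetric] inner_xy[symmetric] inner_commute)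
    also have "\<dots> = (norm ?u)\<^sup>2"
      by (simp add: matrix_vector_mul_assoc[symmetric] inner_xy[symmetric] power2_norm_eq_inner)
    finally have "lambda_min ?B / (\<eta> + \<beta>) * (norm b)\<^sup>2 \<le> (norm ?u)\<^sup>2 / (\<eta> + \<beta>)"
      using divide_right_mono[OF _ less_imp_le[OF \<eta>\<beta>]] by fastforce
    also have "\<dots> \<le> ?u \<bullet> (matrix_inv (mat \<eta> + hess_xx L z) *v ?u)"
    proof (rule inner_matrix_inv_ge[OF coercive_xx m _ _ \<eta>\<beta>])
      show "u \<bullet> ((mat \<eta> + hess_xx L z) *v v) = v \<bullet> ((mat \<eta> + hess_xx L z) *v u)" for u v
        using inner_xx[of u v] by (simp add: matrix_vector_mult_add_rdistrib mat_mult_vec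
            inner_add_right inner_commute)
      show "v \<bullet> ((mat \<eta> + hess_xx L z) *v v) \<le> (\<eta> + \<beta>) * (norm v)\<^sup>2" for v
        using 1[of v] by (simp add: matrix_vector_mult_add_rdistrib mat_mult_vec
            inner_add_right power2_norm_eq_inner algebra_simps abs_le_iff)
    qed
    finally show ?thesis
      using yy[of b] mult_right_mono[OF y, of "(norm b)\<^sup>2"] by (simp add: algebra_simps)
  qed
qed

end

section \<open>Estimates at the starting point and conclusion\<close>

lemma saddle_hessianI:
  assumes lin: "linear (hess L z)" and self: "\<And>v w. v \<bullet> hess L z w = w \<bullet> hess L z v"
    and wcc: "weakly_convex_concave L \<rho>" and "0 < \<eta>" "\<rho> < \<eta>"
  shows "saddle_operator (hess L z) \<rho> \<eta>"
proof (rule saddle_operator.intro)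
  have xx: "hess_xx L z \<succeq> mat (- \<rho>)" and yy: "- hess_yy L z \<succeq> mat (- \<rho>)"
    using wcc unfolding weakly_convex_concave_def by blast+
  show "- \<rho> * (norm a)\<^sup>2 \<le> (a, 0) \<bullet> hess L z (a, 0)" for a
    using xx unfolding loewner_ge_mat_iff by (simp add: hess_apply[OF lin] inner_Pair)
  show "(0, b) \<bullet> hess L z (0, b) \<le> \<rho> * (norm b)\<^sup>2" for b
    using yy unfolding loewner_ge_mat_iff
    by (simp add: hess_apply[OF lin] inner_Pair uminus_mult_vec)
qed (fact assms)+

text \<open>Carries the curvature \<open>\<mu>\<close> from \<open>(x0, y')\<close> and
  \<open>(x', y0)\<close> over to \<open>(x0, y0)\<close>.\<close>

lemma opnorm_perturbation:
  assumes "opnorm (A - B) \<le> e" "c * (norm v)\<^sup>2 \<le> v \<bullet> (A *v v)"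
  shows "(c - e) * (norm v)\<^sup>2 \<le> v \<bullet> (B *v v)"
proof -
  have "norm ((A *v v) - (B *v v)) \<le> e * norm v"
    using norm_mult_vec_le[of "A - B" v] mult_right_mono[OF assms(1) norm_ge_zero[of v]]
    by (simp add: matrix_vector_mult_diff_rdistrib)
  from inner_perturbation[where S' = "(*v) A" and S = "(*v) B", OF this] assms(2)
  show ?thesis by (simp add: algebra_simps abs_le_iff)
qed

text \<open>Each partial gradient vanishes after one coordinate block is moved back, and on the way
  it changes only through a cross block of the Hessian, bounded by \<open>\<delta>\<close>.\<close>

lemma grad_bound_cross:
  assumes D: "\<And>z. (grad L has_derivative hess L z) (at z)"
    and saddle: "\<And>z. saddle_hessian L z \<rho> \<eta>"
    and \<delta>: "\<And>z. opnorm (hess_xy L z) \<le> \<delta>"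
    and 0: "fst (grad L (x0, y')) = 0" "snd (grad L (x', y0)) = 0"
  shows "norm (grad L (x0, y0)) \<le> \<delta> * norm ((x0, y0) - (x', y'))"
proof -
  have \<delta>0: "0 \<le> \<delta>"
    using order_trans[OF onorm_pos_le[OF matrix_vector_mul_bounded_linear] \<delta>[unfolded opnorm_def]] .
  note blocks = saddle_hessian.blocks[OF saddle]
  have "((\<lambda>v. fst (grad L (x0, v))) has_derivative (\<lambda>h. fst (hess L (x0, v) (0, h)))) (at v)" for v
    by (intro has_derivative_fst has_derivative_compose[OF _ D])
      (auto intro!: derivative_eq_intros)
  then have "norm (fst (grad L (x0, y0)) - fst (grad L (x0, y'))) \<le> \<delta> * norm (y0 - y')"
    by (intro differentiable_bound[of UNIV _ "\<lambda>v h. fst (hess L (x0, v) (0, h))"])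
      (use \<delta> in \<open>auto simp: blocks opnorm_def\<close>)
  then have x: "norm (fst (grad L (x0, y0))) \<le> \<delta> * norm (y0 - y')" using 0 by simp
  have "((\<lambda>u. snd (grad L (u, y0))) has_derivative (\<lambda>h. snd (hess L (u, y0) (h, 0)))) (at u)" for u
    by (intro has_derivative_snd has_derivative_compose[OF _ D])
      (auto intro!: derivative_eq_intros)
  then have "norm (snd (grad L (x0, y0)) - snd (grad L (x', y0))) \<le> \<delta> * norm (x0 - x')"
    by (intro differentiable_bound[of UNIV _ "\<lambda>u h. snd (hess L (u, y0) (h, 0))"])
      (auto simp: blocks intro!: onorm_le saddle_hessian.norm_yx_le[OF saddle \<delta>])
  then have y: "norm (snd (grad L (x0, y0))) \<le> \<delta> * norm (x0 - x')" using 0 by simp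
  have "(norm (grad L (x0, y0)))\<^sup>2 = (norm (fst (grad L (x0, y0))))\<^sup>2 + (norm (snd (grad L (x0, y0))))\<^sup>2"
    by (metis norm_Pair_power2 prod.collapse)
  also have "\<dots> \<le> (\<delta> * norm (y0 - y'))\<^sup>2 + (\<delta> * norm (x0 - x'))\<^sup>2"
    by (intro add_mono power_mono x y norm_ge_zero)
  also have "\<dots> = (\<delta> * norm ((x0, y0) - (x', y')))\<^sup>2"
    by (simp add: norm_Pair_power2 power_mult_distrib algebra_simps)
  finally show ?thesis by (rule power2_le_imp_le) (simp add: \<delta>0)
qed

text \<open>Rearranges the smallness assumption, with \<open>G * K\<close> as the radius around
  \<open>z0\<close>; \<open>H\<close> may vanish.\<close>

lemma damping_radius:
  fixes G H K r h \<alpha> :: real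
  assumes G: "0 \<le> G" and H: "0 \<le> H" and K: "0 < K" and h: "1 + r\<^sup>2 \<le> h" and "0 < \<alpha>"
    and le: "H \<noteq> 0 \<Longrightarrow> G \<le> \<alpha> / (2 * K * H * h)"
  shows "H * (G * K) * (1 + r\<^sup>2) \<le> \<alpha> / 2"
proof (cases "H = 0")
  case False
  with H have H: "0 < H" by simp
  have h0: "0 < h" using h by (smt (verit) zero_le_power2)
  have "H * (G * K) * (1 + r\<^sup>2) \<le> H * (G * K) * h"
    using H G K h by (intro mult_left_mono) auto
  also have "\<dots> \<le> H * (\<alpha> / (2 * K * H * h) * K) * h"
    using H K h0 le by (intro mult_left_mono mult_right_mono) auto
  also have "\<dots> = \<alpha> / 2" using H K h0 by (simp add: field_simps)
  finally show ?thesis .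
qed (use \<open>0 < \<alpha>\<close> in simp)

text \<open>"Nearby" is made quantitative by an explicit radius. Linear convergence is asserted
  separately from the rate because the stated rate equals \<open>1\<close> at the extreme damping
  \<open>2 * (kappa \<eta> \<rho> / (2 * \<eta> / \<alpha>0 + 1))\<close>.\<close>

theorem theorem4p1:
  fixes L :: "(real^'n) \<times> (real^'m) \<Rightarrow> real"
    and \<rho> \<beta> H \<delta> \<xi> \<eta> \<mu> :: real
    and x' x0 :: "real^'n" and y' y0 :: "real^'m"
  assumes "twice_differentiable L"
    and "weakly_convex_concave L \<rho>"
    and "\<beta> \<ge> 0" and "H \<ge> 0" and "\<delta> \<ge> 0" and "\<xi> \<ge> 0"
    and "\<And>z. onorm (hess L z) \<le> \<beta>"
    and "\<And>z w. onorm (\<lambda>h. hess L z h - hess L w h) \<le> H * norm (z - w)"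
    and "\<And>z. opnorm (hess_xy L z) \<le> \<delta>"
    and "\<And>x y w. opnorm (hess_xx L (x, y) - hess_xx L (x, w)) \<le> \<xi> * norm (y - w)"
    and "\<And>x y w. opnorm (hess_yy L (x, y) - hess_yy L (w, y)) \<le> \<xi> * norm (x - w)"
    and "\<eta> > 0" and "\<eta> > \<rho>"
    and "local_minimizer (\<lambda>u. L (u, y')) x0"
    and "local_maximizer (\<lambda>v. L (x', v)) y0"
    and "\<mu> \<ge> 0"
    and "hess_xx L (x0, y') \<succeq> mat \<mu>"
    and "- hess_yy L (x', y0) \<succeq> mat \<mu>"
    and "\<xi> * norm (y0 - y') < \<mu> + lambda_min (hess_xy L (x0, y0) ** hess_yx L (x0, y0)) / (\<eta> + \<beta>)"
    and "\<xi> * norm (x0 - x') < \<mu> + lambda_min (hess_yx L (x0, y0) ** hess_xy L (x0, y0)) / (\<eta> + \<beta>)"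
  shows "(\<exists>\<alpha>0>0. interaction_dominant L \<eta> (x0, y0) \<alpha>0) \<and>
    (\<forall>\<alpha>0>0. \<forall>lam.
       interaction_dominant L \<eta> (x0, y0) \<alpha>0 \<longrightarrow>
       (H \<noteq> 0 \<longrightarrow>
          \<delta> * norm ((x0, y0) - (x', y'))
            \<le> \<alpha>0 * (\<eta> - \<rho>) /
               (2 * (1 + 4 * sqrt 2 * (\<eta> + \<alpha>0 / 2) / \<alpha>0
                       + 4 * sqrt 2 * \<beta> * (\<eta> + \<alpha>0 / 2) / (\<alpha>0 * (\<eta> - \<rho>)))
                  * H * (1 + 2 * \<delta> / (\<eta> - \<rho>) + \<delta>\<^sup>2 / (\<eta> - \<rho>)\<^sup>2))) \<longrightarrow>
       0 < lam \<longrightarrow> lam \<le> 1 \<longrightarrow>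
       lam \<le> 2 * (kappa \<eta> \<rho> / (2 * \<eta> / \<alpha>0 + 1)) \<longrightarrow>
       (\<exists>zs. stationary_point L zs \<and>
          norm (zs - (x0, y0))
            \<le> 4 * sqrt 2 * (\<eta> + \<alpha>0 / 2) / \<alpha>0 * (\<delta> * norm ((x0, y0) - (x', y')) / (\<eta> - \<rho>)) \<and>
          linearly_converges (damped_ppm L \<eta> lam (x0, y0)) zs \<and>
          (\<forall>k. (norm (damped_ppm L \<eta> lam (x0, y0) k - zs))\<^sup>2
                 \<le> (1 - 2 * lam / (2 * \<eta> / \<alpha>0 + 1) + lam\<^sup>2 / kappa \<eta> \<rho>) ^ k
                    * (norm ((x0, y0) - zs))\<^sup>2)))"
proof -
  note twice = assms(1) and wcc = assms(2) and \<beta> = assms(3) and H = assms(4) and \<delta> = assms(5)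
    and onorm_le = assms(7) and onorm_lip = assms(8) and xy = assms(9) and xx_lip = assms(10)
    and yy_lip = assms(11) and \<eta> = assms(12) and \<rho> = assms(13)
    and x0 = assms(14) and y0 = assms(15) and xx = assms(17) and yy = assms(18)
    and small_y = assms(19) and small_x = assms(20)
  let ?z0 = "(x0, y0)" and ?z' = "(x', y')"
  have L': "GDERIV L z :> grad L z" for z
    using twice unfolding twice_differentiable_def by (blast intro: gderiv_grad)
  have D: "(grad L has_derivative hess L z) (at z)" for z
    using twice unfolding twice_differentiable_def hess_def frechet_derivative_works by blast
  have bl: "bounded_linear (hess L z)" for z using D by (rule has_derivative_bounded_linear)
  have bound: "norm (hess L z w) \<le> \<beta> * norm w" for z w
    using onorm[OF bl] mult_right_mono[OF onorm_le norm_ge_zero] by (rule order_trans)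
  have lip: "norm (hess L z h - hess L w h) \<le> H * norm (z - w) * norm h" for z w h
    using onorm[OF bounded_linear_sub[OF bl bl]] mult_right_mono[OF onorm_lip norm_ge_zero]
    by (rule order_trans)
  have saddle: "saddle_operator (hess L z) \<rho> \<eta>" for z
    by (intro saddle_hessianI wcc \<eta> \<rho> bounded_linear.linear[OF bl] hessian_symmetric[OF L' D lip H])
  interpret hessian_field "grad L" "hess L" \<rho> \<eta> \<beta> H
    by (rule hessian_field.intro) (fact D saddle bound lip \<beta> H)+
  interpret z0: saddle_hessian L ?z0 \<rho> \<eta>
    using saddle by (simp add: saddle_hessian_def)

  have ex: "\<exists>\<alpha>0>0. interaction_dominant L \<eta> ?z0 \<alpha>0"
  proof -
    \<comment> \<open>Lower bounds for the curvature of the diagonal blocks at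
      \<open>(x0, y0)\<close>. The strict smallness assumptions make both entries of the minimum
      \<open>\<alpha>\<close> positive.\<close>
    define c d where "c = \<mu> - \<xi> * norm (y0 - y')" and "d = \<mu> - \<xi> * norm (x0 - x')"
    define \<alpha> where "\<alpha> = min (c + lambda_min (hess_xy L ?z0 ** hess_yx L ?z0) / (\<eta> + \<beta>))
      (d + lambda_min (hess_yx L ?z0 ** hess_xy L ?z0) / (\<eta> + \<beta>))"
    have "0 < \<alpha>" using small_x small_y by (simp add: \<alpha>_def c_def d_def)
    moreover have "interaction_dominant L \<eta> ?z0 \<alpha>"
    proof (rule z0.interaction_dominant_if[OF bound \<beta>])
      show "c * (norm a)\<^sup>2 \<le> a \<bullet> (hess_xx L ?z0 *v a)" for a
        unfolding c_def
        by (rule opnorm_perturbation[of "hess_xx L (x0, y')"])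
          (use xx_lip[of x0 y' y0] xx in \<open>auto simp: loewner_ge_mat_iff norm_minus_commute\<close>)
      have "opnorm (- hess_yy L (x', y0) - (- hess_yy L ?z0)) \<le> \<xi> * norm (x0 - x')"
        using yy_lip[of x0 y0 x'] by (simp add: algebra_simps)
      from opnorm_perturbation[OF this] yy
      show "d * (norm b)\<^sup>2 \<le> - (b \<bullet> (hess_yy L ?z0 *v b))" for b
        by (simp add: d_def loewner_ge_mat_iff uminus_mult_vec)
    qed (auto simp: \<alpha>_def)
    ultimately show ?thesis by blast
  qed

  have prox: "prox L \<eta> z = resolvent z" for z
    unfolding prox_def by (rule resolvent_eq_saddle_point[OF L', symmetric])
  have "fst (grad L (x0, y')) = 0" "snd (grad L (x', y0)) = 0"
    using local_extremum_gradient_zero[OF has_derivative_partial_fst[OF L'[unfolded gderiv_def]]] x0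
      local_extremum_gradient_zero[OF has_derivative_partial_snd[OF L'[unfolded gderiv_def]]] y0
    by blast+
  then have g0: "norm (grad L ?z0) \<le> \<delta> * norm (?z0 - ?z')"
    by (intro grad_bound_cross[OF D saddle_hessian.intro[OF saddle] xy])
  \<comment> \<open>Bounds the displacement of the first proximal step, by \<open>g0\<close> and
    \<open>resolvent_displacement\<close>.\<close>
  define G where "G = \<delta> * norm (?z0 - ?z') / (\<eta> - \<rho>)"
  have G: "0 \<le> G" using \<delta> \<rho> by (simp add: G_def)
  define r where "r = \<delta> / (\<eta> - \<rho>)"

  have conv: "\<exists>zs. stationary_point L zs \<and>
      norm (zs - ?z0) \<le> 4 * sqrt 2 * (\<eta> + \<alpha> / 2) / \<alpha> * G \<and>
      linearly_converges (damped_ppm L \<eta> lam ?z0) zs \<and>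
      (\<forall>k. (norm (damped_ppm L \<eta> lam ?z0 k - zs))\<^sup>2
        \<le> (1 - 2 * lam / (2 * \<eta> / \<alpha> + 1) + lam\<^sup>2 / kappa \<eta> \<rho>) ^ k * (norm (?z0 - zs))\<^sup>2)"
    if \<alpha>: "0 < \<alpha>" and dom: "interaction_dominant L \<eta> ?z0 \<alpha>"
      and le: "H \<noteq> 0 \<longrightarrow> \<delta> * norm (?z0 - ?z')
        \<le> \<alpha> * (\<eta> - \<rho>) /
            (2 * (1 + 4 * sqrt 2 * (\<eta> + \<alpha> / 2) / \<alpha>
                    + 4 * sqrt 2 * \<beta> * (\<eta> + \<alpha> / 2) / (\<alpha> * (\<eta> - \<rho>)))
               * H * (1 + 2 * \<delta> / (\<eta> - \<rho>) + \<delta>\<^sup>2 / (\<eta> - \<rho>)\<^sup>2))"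
      and lam: "0 < lam" "lam \<le> 2 * (kappa \<eta> \<rho> / (2 * \<eta> / \<alpha> + 1))"
    for \<alpha> lam
  proof -
    define R where "R = 4 * sqrt 2 * (\<eta> + \<alpha> / 2) / \<alpha> * G"
    \<comment> \<open>Chosen so that \<open>G * K\<close> is the radius
      \<open>G + R + \<beta> * R / (\<eta> - \<rho>)\<close> from
      \<open>resolvent_near\<close>.\<close>
    define K where "K = 1 + 4 * sqrt 2 * (\<eta> + \<alpha> / 2) / \<alpha>
      + 4 * sqrt 2 * \<beta> * (\<eta> + \<alpha> / 2) / (\<alpha> * (\<eta> - \<rho>))"
    \<comment> \<open>This is \<open>(1 + r)\<^sup>2\<close>, an upper bound for the perturbation
      factor \<open>1 + r\<^sup>2\<close>.\<close>
    define h where "h = 1 + 2 * \<delta> / (\<eta> - \<rho>) + \<delta>\<^sup>2 / (\<eta> - \<rho>)\<^sup>2"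
    have GK: "G * K = G + R + \<beta> * R / (\<eta> - \<rho>)"
      using \<alpha> \<rho> by (simp add: K_def R_def field_simps)
    have radius: "H * (G * K) * (1 + r\<^sup>2) \<le> \<alpha> / 2"
    proof (rule damping_radius[OF G H _ _ \<alpha>])
      show "0 < K" unfolding K_def using \<alpha> \<eta> \<rho> \<beta>
        by (intro add_pos_nonneg divide_nonneg_nonneg mult_nonneg_nonneg) auto
      show "1 + r\<^sup>2 \<le> h" using \<delta> \<rho> by (simp add: r_def h_def power_divide)
      show "G \<le> \<alpha> / (2 * K * H * h)" if "H \<noteq> 0"
      proof -
        have "\<delta> * norm (?z0 - ?z') \<le> \<alpha> * (\<eta> - \<rho>) / (2 * K * H * h)"
          using le that unfolding K_def h_def by blast
        from divide_right_mono[OF this, of "\<eta> - \<rho>"] \<rho> show ?thesis by (simp add: G_def)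
      qed
    qed
    have dom': "dominant r \<alpha> (hess L ?z0)"
      unfolding dominant_def r_def using z0.interaction_dominant_imp[OF dom xy] by blast
    have g0': "norm (grad L ?z0) \<le> (\<eta> - \<rho>) * G" using g0 \<rho> by (simp add: G_def)
    show ?thesis
      unfolding stationary_point_def R_def[symmetric]
      by (rule damped_resolvent_converges[OF dom' \<alpha> g0' R_def radius[unfolded GK] lam])
        (simp_all add: step_def prox)
  qed
  show ?thesis using ex conv unfolding G_def by blast
qed

end
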